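(* Let $\beta>1$, let $(\Sigma_\beta,\sigma_\beta)$ be the $\beta$-shift with the metric $d_\beta$, let $X=[0,1)$ with the Euclidean metric, and let $f_\beta:X\to X$, $f_\beta(x)=\beta x\ (\mathrm{mod}\ 1)$. (1) If $\varphi\in C(\Sigma_\beta)$ and the set $\widehat\Sigma_\beta(\varphi,\sigma_\beta)=\{x\in\Sigma_\beta:\lim_{n\to\infty}\frac1n\sum_{i=0}^{n-1}\varphi(\sigma_\beta^i(x))\text{ does not exist}\}$ is non-empty, then $\mathrm{Dim}_H(\widehat\Sigma_\beta(\varphi,\sigma_\beta))=1$. (2) If $\varphi\in C([0,1])$ and the set $\widehat X(\varphi,f_\beta)=\{x\in X:\lim_{n\to\infty}\frac1n\sum_{i=0}^{n-1}\varphi(f_\beta^i(x))\text{ does not exist}\}$ is non-empty, then $\mathrm{Dim}_H(\widehat X(\varphi,f_\beta))=1$.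
   Context: $C(\cdot)$ denotes continuous real-valued functions. **$\beta$-shift.** Let $b=\lfloor\beta\rfloor$ if $\beta\notin\mathbb{N}$ and $b=\beta-1$ if $\beta\in\mathbb{N}$. Let $J_i=[\frac i\beta,\frac{i+1}\beta)$ for $0\le i\le b-1$ and $J_b=[\frac b\beta,1)$. For $x\in[0,1)$ let $w(x)=(w_j(x))_{j\ge1}$, where $w_j(x)=i$ when $f_\beta^{j-1}(x)\in J_i$ (the greedy $\beta$-expansion of $x$). $\Sigma_\beta$ is the closure of $\{w(x):x\in[0,1)\}$ in $\prod_{i=1}^\infty\{0,\dots,b\}$ with the product topology, and $\sigma_\beta$ is the left shift on $\Sigma_\beta$. **Metric.** $d_\beta(x,y)=\beta^{-n}$, where $n\ge0$ is the smallest integer with $x_{n+1}\ne y_{n+1}$ (and $d_\beta(x,x)=0$). **Hausdorff dimension.** $\mathrm{Dim}_H$ is Hausdorff dimension: with $|B|$ the diameter of $B$, $H(Z,\alpha,\delta)=\inf\{\sum_i|B(x_i,\delta_i)|^\alpha:Z\subseteq\bigcup_iB(x_i,\delta_i),\ \delta_i\le\delta\}$ over finite or countable covers, $H(Z,\alpha)=\lim_{\delta\to0}H(Z,\alpha,\delta)$, and $\mathrm{Dim}_H(Z)=\sup\{\alpha:H(Z,\alpha)=\infty\}$. It is taken with respect to $d_\beta$ in (1) and the Euclidean metric in (2). *)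

theory Defs
  imports "HOL-Analysis.Analysis"
begin

section \<open>Hausdorff dimension\<close>

text \<open>
  The metric space is given by a carrier \<open>M\<close> and a distance \<open>d\<close>, as in the locale
  \<^locale>\<open>Metric_space\<close>; \<open>mdiam\<close> is the analogue of \<^const>\<open>diameter\<close> in this setting.
\<close>

definition mdiam :: "('a \<Rightarrow> 'a \<Rightarrow> real) \<Rightarrow> 'a set \<Rightarrow> real" where
  "mdiam d S = (if S = {} then 0 else SUP (x, y) \<in> S \<times> S. d x y)"

text \<open>
  A finite or countable family of balls is indexed by an arbitrary set \<open>I\<close> of natural
  numbers. The balls are the open balls of the space \<open>M\<close>, with centres in \<open>M\<close>. The case
  distinction in \<open>diam_power\<close> is needed because of the library convention \<open>0 powr 0 = 0\<close>:
  the exponent \<open>0\<close> has to give the value \<open>1\<close> for every ball.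
\<close>

definition diam_power :: "('a \<Rightarrow> 'a \<Rightarrow> real) \<Rightarrow> real \<Rightarrow> 'a set \<Rightarrow> ennreal" where
  "diam_power d \<alpha> B = (if \<alpha> = 0 then 1 else ennreal (mdiam d B powr \<alpha>))"

definition hausdorff_pre ::
    "'a set \<Rightarrow> ('a \<Rightarrow> 'a \<Rightarrow> real) \<Rightarrow> 'a set \<Rightarrow> real \<Rightarrow> real \<Rightarrow> ennreal" where
  "hausdorff_pre M d Z \<alpha> \<delta> =
     Inf {(\<Sum>\<^sub>\<infinity>i\<in>I. diam_power d \<alpha> (Metric_space.mball M d (x i) (r i)))
          | (I :: nat set) x r.
            (\<forall>i\<in>I. x i \<in> M \<and> 0 < r i \<and> r i \<le> \<delta>) \<and>
            Z \<subseteq> (\<Union>i\<in>I. Metric_space.mball M d (x i) (r i))}"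

definition hausdorff_measure ::
    "'a set \<Rightarrow> ('a \<Rightarrow> 'a \<Rightarrow> real) \<Rightarrow> 'a set \<Rightarrow> real \<Rightarrow> ennreal" where
  "hausdorff_measure M d Z \<alpha> = Lim (at_right 0) (hausdorff_pre M d Z \<alpha>)"

text \<open>The supremum is taken in \<^typ>\<open>ennreal\<close>, so that the supremum of the empty set is \<open>0\<close>.\<close>

definition hausdorff_dim ::
    "'a set \<Rightarrow> ('a \<Rightarrow> 'a \<Rightarrow> real) \<Rightarrow> 'a set \<Rightarrow> ennreal" where
  "hausdorff_dim M d Z = Sup {ennreal \<alpha> | \<alpha>. 0 \<le> \<alpha> \<and> hausdorff_measure M d Z \<alpha> = \<infinity>}"

text \<open>The limit in \<^const>\<open>hausdorff_measure\<close> always exists.\<close>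

lemma hausdorff_pre_antimono:
  assumes "\<delta> \<le> \<delta>'"
  shows "hausdorff_pre M d Z \<alpha> \<delta>' \<le> hausdorff_pre M d Z \<alpha> \<delta>"
  unfolding hausdorff_pre_def
  using assms
  by (intro Inf_superset_mono Collect_mono ex_mono conj_mono impI) (auto intro: order_trans)

lemma tendsto_hausdorff_measure:
  "(hausdorff_pre M d Z \<alpha> \<longlongrightarrow> hausdorff_measure M d Z \<alpha>) (at_right 0)"
proof -
  let ?h = "hausdorff_pre M d Z \<alpha>"
  have "(?h \<longlongrightarrow> (SUP \<delta>\<in>{0<..}. ?h \<delta>)) (at_right 0)"
  proof (rule order_tendstoI)
    fix a assume "a < (SUP \<delta>\<in>{0<..}. ?h \<delta>)"
    then obtain e where e: "e > 0" "a < ?h e"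
      by (auto simp: less_SUP_iff)
    have "a < ?h x" if "x < e" for x
      using e(2) hausdorff_pre_antimono[of x e] that by (meson less_le_trans less_imp_le)
    then show "\<forall>\<^sub>F x in at_right 0. a < ?h x"
      unfolding eventually_at_right_field using e(1) by blast
  next
    fix a assume a: "(SUP \<delta>\<in>{0<..}. ?h \<delta>) < a"
    have "?h x < a" if "x > 0" for x
      using that by (intro le_less_trans[OF _ a] SUP_upper) auto
    then show "\<forall>\<^sub>F x in at_right 0. ?h x < a"
      unfolding eventually_at_right_field by (auto intro: exI[of _ 1])
  qed
  then show ?thesis
    unfolding hausdorff_measure_def using tendsto_Lim trivial_limit_at_right_real by metis
qed


section \<open>The \<open>\<beta>\<close>-transformation and the \<open>\<beta>\<close>-shift\<close>

definition beta_map :: "real \<Rightarrow> real \<Rightarrow> real" where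
  "beta_map \<beta> x = frac (\<beta> * x)"

definition max_digit :: "real \<Rightarrow> nat" where
  "max_digit \<beta> = (if \<beta> \<in> \<nat> then nat \<lfloor>\<beta>\<rfloor> - 1 else nat \<lfloor>\<beta>\<rfloor>)"

definition digit_interval :: "real \<Rightarrow> nat \<Rightarrow> real set" where
  "digit_interval \<beta> i =
     (if i < max_digit \<beta> then {real i / \<beta> ..< (real i + 1) / \<beta>} else {real i / \<beta> ..< 1})"

text \<open>
  Sequences are indexed from \<open>0\<close>, so \<open>beta_expansion \<beta> x j\<close> is the digit with index \<open>j + 1\<close>
  in the usual numbering from \<open>1\<close>.
\<close>

definition beta_expansion :: "real \<Rightarrow> real \<Rightarrow> nat \<Rightarrow> nat" where
  "beta_expansion \<beta> x j =
     (THE i. i \<le> max_digit \<beta> \<and> (beta_map \<beta> ^^ j) x \<in> digit_interval \<beta> i)"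

definition full_shift_topology :: "real \<Rightarrow> (nat \<Rightarrow> nat) topology" where
  "full_shift_topology \<beta> = product_topology (\<lambda>_. discrete_topology {0..max_digit \<beta>}) UNIV"

definition beta_shift :: "real \<Rightarrow> (nat \<Rightarrow> nat) set" where
  "beta_shift \<beta> = full_shift_topology \<beta> closure_of (beta_expansion \<beta> ` {0..<1})"

definition shift :: "(nat \<Rightarrow> 'a) \<Rightarrow> nat \<Rightarrow> 'a" where
  "shift s = (\<lambda>n. s (Suc n))"

definition beta_dist :: "real \<Rightarrow> (nat \<Rightarrow> nat) \<Rightarrow> (nat \<Rightarrow> nat) \<Rightarrow> real" where
  "beta_dist \<beta> s t = (if s = t then 0 else (1 / \<beta>) ^ (LEAST n. s n \<noteq> t n))"

text \<open>\<^const>\<open>digit_interval\<close> partitions the unit interval, so digits are well defined.\<close>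

lemma digit_ex1:
  assumes "\<beta> > 1" "0 \<le> y" "y < 1"
  shows "\<exists>!i. i \<le> max_digit \<beta> \<and> y \<in> digit_interval \<beta> i"
proof -
  let ?b = "max_digit \<beta>"
  have b: "real ?b < \<beta>" "\<beta> \<le> real ?b + 1"
  proof -
    have "real ?b < \<beta> \<and> \<beta> \<le> real ?b + 1"
    proof (cases "\<beta> \<in> \<nat>")
      case True
      then obtain n where "\<beta> = real n" by (auto elim: Nats_cases)
      then show ?thesis using assms(1) by (simp add: max_digit_def of_nat_diff)
    next
      case False
      have "real (nat \<lfloor>\<beta>\<rfloor>) \<noteq> \<beta>"
        using False of_nat_in_Nats by metis
      moreover have "real (nat \<lfloor>\<beta>\<rfloor>) \<le> \<beta>" "\<beta> \<le> real (nat \<lfloor>\<beta>\<rfloor>) + 1"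
        using assms(1) by linarith+
      ultimately have "real (nat \<lfloor>\<beta>\<rfloor>) < \<beta> \<and> \<beta> \<le> real (nat \<lfloor>\<beta>\<rfloor>) + 1" by linarith
      then show ?thesis using False unfolding max_digit_def by (simp only: if_False)
    qed
    then show "real ?b < \<beta>" "\<beta> \<le> real ?b + 1" by auto
  qed
  have mem: "y \<in> digit_interval \<beta> i \<longleftrightarrow> nat \<lfloor>\<beta> * y\<rfloor> = i" if i: "i \<le> ?b" for i
  proof -
    have y0: "0 \<le> \<beta> * y" and y1: "\<beta> * y < \<beta>" using assms by auto
    have "y \<in> digit_interval \<beta> i \<longleftrightarrow> real i \<le> \<beta> * y \<and> \<beta> * y < real i + 1"
    proof (cases "i < ?b")
      case True
      then show ?thesis using assms by (auto simp: digit_interval_def field_simps)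
    next
      case False
      then have "i = ?b" using i by simp
      moreover have "\<beta> * y < real ?b + 1" using b(2) y1 by linarith
      ultimately show ?thesis using assms by (simp add: digit_interval_def field_simps)
    qed
    also have "\<dots> \<longleftrightarrow> nat \<lfloor>\<beta> * y\<rfloor> = i" using y0 by linarith
    finally show ?thesis .
  qed
  have "\<beta> * y < \<beta>" "0 \<le> \<beta> * y" using assms by auto
  then have "nat \<lfloor>\<beta> * y\<rfloor> \<le> ?b" using b(2) by linarith
  then show ?thesis using mem by (intro ex1I[of _ "nat \<lfloor>\<beta> * y\<rfloor>"]) blast+
qed

lemma Metric_space_beta_dist:
  assumes "\<beta> > 1"
  shows "Metric_space M (beta_dist \<beta>)"
proof
  fix x y z :: "nat \<Rightarrow> nat"
  show "0 \<le> beta_dist \<beta> x y" using assms by (simp add: beta_dist_def)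
  show "beta_dist \<beta> x y = beta_dist \<beta> y x" by (simp add: beta_dist_def eq_commute)
  show "beta_dist \<beta> x y = 0 \<longleftrightarrow> x = y" using assms by (simp add: beta_dist_def)
  show "beta_dist \<beta> x z \<le> beta_dist \<beta> x y + beta_dist \<beta> y z"
  proof (cases "x = y \<or> y = z \<or> x = z")
    case True
    then show ?thesis using assms by (auto simp: beta_dist_def)
  next
    case False
    let ?k = "LEAST n. x n \<noteq> z n"
    obtain m where "x m \<noteq> z m" using False by blast
    then have "x ?k \<noteq> z ?k" by (rule LeastI)
    then have "x ?k \<noteq> y ?k \<or> y ?k \<noteq> z ?k" by auto
    then have "(LEAST n. x n \<noteq> y n) \<le> ?k \<or> (LEAST n. y n \<noteq> z n) \<le> ?k"
      using Least_le[of "\<lambda>n. x n \<noteq> y n" ?k] Least_le[of "\<lambda>n. y n \<noteq> z n" ?k] by blast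
    moreover have "(1 / \<beta>) ^ ?k \<le> (1 / \<beta>) ^ m" if "m \<le> ?k" for m
      using that assms by (intro power_decreasing) auto
    ultimately have "(1 / \<beta>) ^ ?k \<le> (1 / \<beta>) ^ (LEAST n. x n \<noteq> y n) \<or>
        (1 / \<beta>) ^ ?k \<le> (1 / \<beta>) ^ (LEAST n. y n \<noteq> z n)" by blast
    moreover have "0 \<le> (1 / \<beta>) ^ m" for m :: nat using assms by simp
    ultimately have "(1 / \<beta>) ^ ?k \<le>
        (1 / \<beta>) ^ (LEAST n. x n \<noteq> y n) + (1 / \<beta>) ^ (LEAST n. y n \<noteq> z n)"
      by (meson add_increasing add_increasing2)
    then show ?thesis using False by (simp only: beta_dist_def if_False de_Morgan_disj)
  qed
qed


section \<open>Irregular sets\<close>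

definition irregular_set :: "'a set \<Rightarrow> ('a \<Rightarrow> 'a) \<Rightarrow> ('a \<Rightarrow> real) \<Rightarrow> 'a set" where
  "irregular_set X f \<phi> =
     {x \<in> X. \<not> convergent (\<lambda>n. 1 / real n * (\<Sum>i<n. \<phi> ((f ^^ i) x)))}"

end

theory Submission
  imports Defs
begin

text \<open>
  Divergent averages along one orbit give \<open>a < b\<close> and arbitrarily long admissible words whose
  Birkhoff averages lie alternately below \<open>a\<close> and above \<open>b\<close>. Changing one digit makes any
  admissible word freely concatenable, so such words, of length \<open>l\<^sub>k\<close> growing very fast, can be
  inserted into the expansion of an arbitrary \<open>y\<close> after blocks of length \<open>q l\<^sub>k\<close>. If the averages
  along \<open>y\<close> converge, those along the resulting point \<open>h y\<close> do not. A word of length \<open>N\<close> of \<open>h y\<close>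
  determines about \<open>N q / (q + 1)\<close> digits of \<open>y\<close>, up to subexponentially many choices for the
  changed digits. Hence the image of Lebesgue measure under \<open>h\<close> gives mass \<open>O(\<beta>\<^sup>-\<^sup>s\<^sup>N)\<close>, with \<open>s\<close> close
  to \<open>1\<close>, to every cylinder of order \<open>N\<close>, and the dimension is at least \<open>s\<close>.
\<close>

section \<open>Full words\<close>

text \<open>The obstacle is that the branches of the map need not all be onto, so admissible words
  cannot be joined at will. Repairing a junction erases one digit of y, hence \<open>h\<close> need
  not be injective and its image measure has to be bounded by counting the words of y compatible
  with a word of h y. A block of n digits of y leaves a number of choices linear in n, which for
  long blocks is at most \<open>\<beta>\<close> to the power n/q. The resulting exponent is q/(q +
  1), the share of digits that come from y, times 1 - 1/q, the loss by repairs; the product (q -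
  1)/(q + 1) tends to 1 with q. The image measure is expressed by outer measure because
  \<open>h\<close> takes its values by choice. The passage from cylinders to balls differs in the
  two spaces. In the shift, small balls are cylinders. In the interval, cylinders of order N can be
  far shorter than \<open>\<beta>^-N\<close>, and a short interval may meet many of them; but full
  cylinders have exact length, and counting by longest full prefix leaves only linearly many words.
  That factor is absorbed by a small loss in the exponent.\<close>

locale beta_transformation =
  fixes \<beta> :: real
  assumes beta_gt_1: "\<beta> > 1"
begin

abbreviation T :: "real \<Rightarrow> real" where "T \<equiv> beta_map \<beta>"

text \<open>The floor replaces the definite description in \<open>beta_expansion\<close>, with which
  it agrees on [0,1) by \<open>expansion_eq_digit\<close>; digits and orbit then obey the linear
  recursion \<open>iterate_step\<close>.\<close>

definition digit :: "real \<Rightarrow> nat \<Rightarrow> nat" where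
  "digit x k = nat \<lfloor>\<beta> * (T ^^ k) x\<rfloor>"

lemma beta_pos: "\<beta> > 0"
  using beta_gt_1 by simp

lemma beta_pow_pos: "\<beta> ^ n > 0"
  using beta_pos by simp

lemma iterate_in: "x \<in> {0..<1} \<Longrightarrow> (T ^^ n) x \<in> {0..<1}"
  by (cases n) (auto simp: beta_map_def frac_lt_1)

lemma iterate_nonneg: "x \<in> {0..<1} \<Longrightarrow> 0 \<le> (T ^^ n) x"
  and iterate_lt_1: "x \<in> {0..<1} \<Longrightarrow> (T ^^ n) x < 1"
  using iterate_in[of x n] by auto

lemma digit_iterate: "digit ((T ^^ n) x) k = digit x (n + k)"
  unfolding digit_def by (simp add: funpow_add add.commute[of n k])

lemma iterate_step:
  assumes "x \<in> {0..<1}"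
  shows "\<beta> * (T ^^ n) x = real (digit x n) + (T ^^ Suc n) x"
proof -
  have "0 \<le> \<beta> * (T ^^ n) x" using iterate_nonneg[OF assms] beta_pos by simp
  then show ?thesis unfolding digit_def by (simp add: beta_map_def frac_def)
qed

lemma digit_step:
  assumes "x \<in> {0..<1}" "\<beta> * (T ^^ n) x = real d + q" "0 \<le> q" "q < 1"
  shows "digit x n = d" "(T ^^ Suc n) x = q"
proof -
  have "\<lfloor>real d + q\<rfloor> = int d" using assms by linarith
  then show "digit x n = d" "(T ^^ Suc n) x = q"
    unfolding digit_def using assms by (auto simp: beta_map_def frac_def)
qed

lemma expansion_eq_digit:
  assumes "x \<in> {0..<1}"
  shows "beta_expansion \<beta> x j = digit x j" and "digit x j \<le> max_digit \<beta>"
proof -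
  let ?y = "(T ^^ j) x"
  have y: "0 \<le> ?y" "?y < 1" using iterate_in[OF assms, of j] by auto
  let ?i = "beta_expansion \<beta> x j"
  have i: "?i \<le> max_digit \<beta>" "?y \<in> digit_interval \<beta> ?i"
    using theI'[OF digit_ex1[OF beta_gt_1 y]] unfolding beta_expansion_def by auto
  have b: "\<beta> \<le> real (max_digit \<beta>) + 1"
  proof (cases "\<beta> \<in> \<nat>")
    case True
    then obtain n where "\<beta> = real n" by (auto elim: Nats_cases)
    then show ?thesis using beta_gt_1 by (simp add: max_digit_def of_nat_diff)
  next
    case False
    have "\<beta> \<le> real (nat \<lfloor>\<beta>\<rfloor>) + 1" using beta_gt_1 by linarith
    then show ?thesis using False unfolding max_digit_def by (simp only: if_False)
  qed
  have le: "real ?i \<le> \<beta> * ?y"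
    using i(2) beta_pos by (auto simp: digit_interval_def field_simps split: if_splits)
  have lt: "\<beta> * ?y < real ?i + 1"
  proof (cases "?i < max_digit \<beta>")
    case True
    then show ?thesis using i(2) beta_pos by (simp add: digit_interval_def field_simps)
  next
    case False
    \<comment> \<open>The last digit interval is cut off at 1, so the upper bound comes from
      \<open>?y < 1\<close> and \<open>\<beta> \<le> max_digit \<beta> + 1\<close>.\<close>
    have "\<beta> * ?y < \<beta>" using y beta_pos by simp
    then show ?thesis using False i(1) b by simp
  qed
  show "?i = digit x j" unfolding digit_def using le lt by linarith
  then show "digit x j \<le> max_digit \<beta>" using i by simp
qed

text \<open>On a cylinder of order \<open>n\<close> the iterate \<open>T ^^ n\<close> is affine with
  slope \<open>\<beta> ^ n\<close>.\<close>

lemma diff_eq_of_same_digits: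
  assumes "x \<in> {0..<1}" "y \<in> {0..<1}" "\<forall>k<n. digit x k = digit y k"
  shows "x - y = ((T ^^ n) x - (T ^^ n) y) / \<beta> ^ n"
  using assms(3)
proof (induction n)
  case (Suc n)
  have "\<beta> * (T ^^ n) x - \<beta> * (T ^^ n) y = (T ^^ Suc n) x - (T ^^ Suc n) y"
    using iterate_step[OF assms(1), of n] iterate_step[OF assms(2), of n] Suc.prems by simp
  then have "(T ^^ n) x - (T ^^ n) y = ((T ^^ Suc n) x - (T ^^ Suc n) y) / \<beta>"
    using beta_pos by (simp add: field_simps)
  moreover have "x - y = ((T ^^ n) x - (T ^^ n) y) / \<beta> ^ n" using Suc by simp
  ultimately have "x - y = ((T ^^ Suc n) x - (T ^^ Suc n) y) / \<beta> / \<beta> ^ n" by simp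
  then show ?case by (simp add: mult.commute)
qed simp

lemma dist_le_of_same_digits:
  assumes "x \<in> {0..<1}" "y \<in> {0..<1}" "\<forall>k<n. digit x k = digit y k"
  shows "\<bar>x - y\<bar> \<le> 1 / \<beta> ^ n"
proof -
  have "\<bar>(T ^^ n) x - (T ^^ n) y\<bar> \<le> 1"
    using iterate_in[OF assms(1), of n] iterate_in[OF assms(2), of n] by auto
  then show ?thesis
    using beta_pow_pos[of n]
    by (simp add: diff_eq_of_same_digits[OF assms] abs_divide divide_right_mono)
qed

text \<open>Every branch of \<open>T\<close> is increasing and starts at the value 0; a branch can
  only be cut off on the right. So the image of a cylinder contains with any value all smaller
  ones.\<close>

lemma lower_point_in_cylinder:
  assumes "x \<in> {0..<1}" "0 \<le> q" "q \<le> (T ^^ n) x"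
  defines "p \<equiv> x - ((T ^^ n) x - q) / \<beta> ^ n"
  shows "p \<in> {0..<1} \<and> (T ^^ n) p = q \<and> (\<forall>k<n. digit p k = digit x k)"
  using assms(2,3) unfolding p_def
proof (induction n arbitrary: q)
  case 0
  then show ?case using assms(1) by auto
next
  case (Suc n)
  \<comment> \<open>The preimage of \<open>q\<close> under the branch of \<open>T\<close> that
    carries the digit of \<open>x\<close> at place \<open>n\<close>.\<close>
  let ?q = "(real (digit x n) + q) / \<beta>"
  let ?p = "x - ((T ^^ Suc n) x - q) / \<beta> ^ Suc n"
  have step: "\<beta> * (T ^^ n) x = real (digit x n) + (T ^^ Suc n) x"
    by (rule iterate_step[OF assms(1)])
  have q0: "0 \<le> ?q" using Suc.prems beta_pos by simp
  have q1: "?q \<le> (T ^^ n) x"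
    using Suc.prems step beta_pos by (simp add: field_simps)
  have "(T ^^ n) x - ?q = ((T ^^ Suc n) x - q) / \<beta>"
    using step beta_pos by (simp add: field_simps)
  then have p: "x - ((T ^^ n) x - ?q) / \<beta> ^ n = ?p"
    by (simp add: mult.commute)
  note IH = Suc.IH[OF q0 q1, unfolded p]
  have in01: "?p \<in> {0..<1}" and it: "(T ^^ n) ?p = ?q" using IH by auto
  have "\<beta> * (T ^^ n) ?p = real (digit x n) + q" using it beta_pos by simp
  moreover have "q < 1" using Suc.prems iterate_lt_1[OF assms(1), of "Suc n"] by simp
  ultimately have "digit ?p n = digit x n" "(T ^^ Suc n) ?p = q"
    using digit_step[OF in01] Suc.prems by blast+
  then show ?case using IH in01 by (auto simp: less_Suc_eq simp del: funpow.simps)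
qed

text \<open>
  A word that can be followed by every admissible sequence is represented by the left endpoint
  \<open>v\<close> of its cylinder, which is the whole interval \<open>[v, v + \<beta>\<^sup>-\<^sup>n)\<close>.
\<close>

definition full :: "nat \<Rightarrow> real \<Rightarrow> bool" where
  "full n v \<longleftrightarrow> (\<forall>t\<in>{0..<1}. v + t / \<beta> ^ n \<in> {0..<1} \<and> (T ^^ n) (v + t / \<beta> ^ n) = t \<and>
     (\<forall>k<n. digit (v + t / \<beta> ^ n) k = digit v k))"

lemma fullD:
  assumes "full n v" "t \<in> {0..<1}"
  shows "v + t / \<beta> ^ n \<in> {0..<1}" "(T ^^ n) (v + t / \<beta> ^ n) = t"
    "\<And>k. k < n \<Longrightarrow> digit (v + t / \<beta> ^ n) k = digit v k"
  using assms unfolding full_def by blast+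

lemma full_left_endpoint:
  assumes "full n v"
  shows "v \<in> {0..<1}" "(T ^^ n) v = 0"
  using fullD[OF assms, of 0] by auto

text \<open>Otherwise 1 itself would have the form \<open>v + t / \<beta> ^ n\<close> with
  \<open>t < 1\<close>, but all these points lie in [0,1).\<close>

lemma full_right_endpoint:
  assumes "full n v"
  shows "v + 1 / \<beta> ^ n \<le> 1"
proof (rule ccontr)
  assume "\<not> ?thesis"
  then have *: "1 - v < 1 / \<beta> ^ n" by simp
  have v: "v < 1" "0 \<le> v" using full_left_endpoint[OF assms] by auto
  have "(1 - v) * \<beta> ^ n < 1" using * beta_pow_pos[of n] by (simp only: pos_less_divide_eq)
  then have "v + ((1 - v) * \<beta> ^ n) / \<beta> ^ n \<in> {0..<1}"
    using fullD(1)[OF assms, of "(1 - v) * \<beta> ^ n"] v beta_pow_pos[of n] by simp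
  then show False using beta_pos by simp
qed

lemma full_0: "full 0 0"
  by (simp add: full_def)

lemma full_append:
  assumes "full n v" "full m u"
  shows "full (n + m) (v + u / \<beta> ^ n)"
    and "\<And>k. k < n \<Longrightarrow> digit (v + u / \<beta> ^ n) k = digit v k"
    and "\<And>k. k < m \<Longrightarrow> digit (v + u / \<beta> ^ n) (n + k) = digit u k"
proof -
  have u: "u \<in> {0..<1}" using full_left_endpoint[OF assms(2)] by auto
  show a: "digit (v + u / \<beta> ^ n) k = digit v k" if "k < n" for k
    using fullD(3)[OF assms(1) u that] .
  show b: "digit (v + u / \<beta> ^ n) (n + k) = digit u k" for k
    using digit_iterate[of n "v + u / \<beta> ^ n" k] fullD(2)[OF assms(1) u] by simp
  show "full (n + m) (v + u / \<beta> ^ n)"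
    unfolding full_def
  proof (intro ballI)
    fix t :: real assume t: "t \<in> {0..<1}"
    let ?r = "u + t / \<beta> ^ m"
    have r: "?r \<in> {0..<1}" using fullD(1)[OF assms(2) t] .
    have eq: "v + u / \<beta> ^ n + t / \<beta> ^ (n + m) = v + ?r / \<beta> ^ n"
      by (simp add: power_add add_divide_distrib mult.commute)
    have "digit (v + ?r / \<beta> ^ n) k = digit (v + u / \<beta> ^ n) k" if "k < n + m" for k
    proof (cases "k < n")
      case True
      then show ?thesis using fullD(3)[OF assms(1) r] a by simp
    next
      case False
      then obtain i where i: "k = n + i" "i < m" using \<open>k < n + m\<close> less_imp_add_positive
        by (metis add_less_cancel_left le_iff_add not_le)
      have "digit (v + ?r / \<beta> ^ n) k = digit ?r i"
        using digit_iterate[of n "v + ?r / \<beta> ^ n" i] fullD(2)[OF assms(1) r] i by simp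
      also have "\<dots> = digit u i" using fullD(3)[OF assms(2) t] i by simp
      finally show ?thesis using b[of i] i by simp
    qed
    moreover have "(T ^^ (n + m)) (v + ?r / \<beta> ^ n) = t"
      using fullD(2)[OF assms(1) r] fullD(2)[OF assms(2) t]
      by (simp add: funpow_add add.commute[of n m])
    ultimately show "v + u / \<beta> ^ n + t / \<beta> ^ (n + m) \<in> {0..<1} \<and>
        (T ^^ (n + m)) (v + u / \<beta> ^ n + t / \<beta> ^ (n + m)) = t \<and>
        (\<forall>k<n + m. digit (v + u / \<beta> ^ n + t / \<beta> ^ (n + m)) k = digit (v + u / \<beta> ^ n) k)"
      unfolding eq using fullD(1)[OF assms(1) r] by blast
  qed
qed

text \<open>The branch of a smaller digit \<open>d\<close> lies wholly below
  \<open>(T ^^ n) x\<close>, so \<open>lower_point_in_cylinder\<close> reaches all of it. This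
  produces the full words in \<open>full_modification\<close> and, read contrapositively, gives
  \<open>same_digits_of_not_full_at\<close>.\<close>

lemma full_lower_digit:
  assumes "x \<in> {0..<1}" "d < digit x n"
  obtains v where "full (Suc n) v" "\<forall>k<n. digit v k = digit x k" "digit v n = d"
    "v + 1 / \<beta> ^ Suc n \<le> x"
proof -
  \<comment> \<open>The point of the cylinder of \<open>x\<close> whose \<open>n\<close>-th iterate
    is the left end of the branch \<open>d\<close>.\<close>
  define v where "v = x - ((T ^^ n) x - real d / \<beta>) / \<beta> ^ n"
  have step: "\<beta> * (T ^^ n) x = real (digit x n) + (T ^^ Suc n) x"
    by (rule iterate_step[OF assms(1)])
  have d: "real d + 1 \<le> real (digit x n)" using assms(2) by linarith
  have dd: "real d + 1 \<le> \<beta> * (T ^^ n) x"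
    using d step iterate_nonneg[OF assms(1), of "Suc n"] by linarith
  have *: "v + t / \<beta> ^ Suc n \<in> {0..<1} \<and> (T ^^ Suc n) (v + t / \<beta> ^ Suc n) = t \<and>
      (\<forall>k<n. digit (v + t / \<beta> ^ Suc n) k = digit x k) \<and> digit (v + t / \<beta> ^ Suc n) n = d"
    if t: "t \<in> {0..<1}" for t
  proof -
    let ?q = "(real d + t) / \<beta>"
    have q: "0 \<le> ?q" "?q \<le> (T ^^ n) x"
      using t dd beta_pos by (auto simp: field_simps)
    have eq: "v + t / \<beta> ^ Suc n = x - ((T ^^ n) x - ?q) / \<beta> ^ n"
      unfolding v_def using beta_pos by (simp add: field_simps)
    note L = lower_point_in_cylinder[OF assms(1) q, folded eq]
    have "\<beta> * (T ^^ n) (v + t / \<beta> ^ Suc n) = real d + t" using L beta_pos by simp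
    then show ?thesis using digit_step[of "v + t / \<beta> ^ Suc n" n d t] L t by auto
  qed
  have v: "\<forall>k<n. digit v k = digit x k" "digit v n = d" using *[of 0] by auto
  show ?thesis
  proof
    show "full (Suc n) v"
      unfolding full_def using * v by (auto simp: less_Suc_eq simp del: funpow.simps power_Suc)
    show "v + 1 / \<beta> ^ Suc n \<le> x"
      unfolding v_def using dd beta_pos by (simp add: field_simps)
  qed (use v in auto)
qed

text \<open>As \<open>\<beta> > 1\<close>, the branch of the digit 0 is mapped onto [0,1).\<close>

lemma full_append_zero:
  assumes "full n v"
  shows "full (Suc n) v" "digit v n = 0"
proof -
  have *: "v + t / \<beta> ^ Suc n \<in> {0..<1} \<and> (T ^^ Suc n) (v + t / \<beta> ^ Suc n) = t \<and>
      (\<forall>k<n. digit (v + t / \<beta> ^ Suc n) k = digit v k) \<and> digit (v + t / \<beta> ^ Suc n) n = 0"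
    if t: "t \<in> {0..<1}" for t
  proof -
    have q: "t / \<beta> \<in> {0..<1}" using t beta_gt_1 by (auto simp: field_simps)
    have eq: "v + t / \<beta> ^ Suc n = v + (t / \<beta>) / \<beta> ^ n" by simp
    have "\<beta> * (T ^^ n) (v + (t / \<beta>) / \<beta> ^ n) = real 0 + t"
      using fullD(2)[OF assms q] beta_pos by simp
    then show ?thesis
      unfolding eq using digit_step[OF fullD(1)[OF assms q], of n 0 t] fullD[OF assms q] t by auto
  qed
  show "digit v n = 0" using *[of 0] by auto
  then show "full (Suc n) v"
    unfolding full_def using * by (auto simp: less_Suc_eq simp del: funpow.simps power_Suc)
qed

text \<open>
  Decreasing the last nonzero digit of an admissible word by one makes the word full.
\<close>

lemma full_modification:
  assumes "x \<in> {0..<1}"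
  shows "\<exists>v. full n v \<and> (n > 0 \<longrightarrow> v + 1 / \<beta> ^ n < 1) \<and> (\<exists>j. \<forall>k<n. k \<noteq> j \<longrightarrow> digit v k = digit x k)"
proof (induction n)
  case 0
  show ?case using full_0 by auto
next
  case (Suc n)
  show ?case
  proof (cases "digit x n")
    case 0
    from Suc obtain v j where v: "full n v" "\<forall>k<n. k \<noteq> j \<longrightarrow> digit v k = digit x k" by blast
    \<comment> \<open>Shrinking the cylinder makes the bound of \<open>full_right_endpoint\<close>
      strict, also at \<open>n = 0\<close>, where the induction hypothesis offers no strict
      bound.\<close>
    have "1 / \<beta> ^ Suc n < 1 / \<beta> ^ n"
      using beta_gt_1 by (simp add: field_simps)
    then have "v + 1 / \<beta> ^ Suc n < 1" using full_right_endpoint[OF v(1)] by linarith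
    then show ?thesis using full_append_zero[OF v(1)] v(2) 0 by (metis less_SucE)
  next
    case (Suc d)
    \<comment> \<open>A nonzero last digit is lowered in the word of \<open>x\<close> itself and not
      in the word from the induction hypothesis, so only one place is ever changed.\<close>
    then have "d < digit x n" by simp
    from full_lower_digit[OF assms this] obtain v where
      v: "full (Suc n) v" "\<forall>k<n. digit v k = digit x k" "v + 1 / \<beta> ^ Suc n \<le> x" by blast
    have "v + 1 / \<beta> ^ Suc n < 1" using v(3) assms by auto
    then show ?thesis using v by (metis less_Suc_eq)
  qed
qed

text \<open>The cylinders of the partial words are nested half-open intervals
  \<open>[v k, r k)\<close>, whose intersection would be empty if the left endpoints increased to a
  common right endpoint. The strict second hypothesis makes \<open>r\<close> strictly decreasing, so
  the supremum of the left endpoints lies below every \<open>r k\<close>.\<close>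

lemma full_concatenation:
  fixes m :: "nat \<Rightarrow> nat" and u :: "nat \<Rightarrow> real"
  assumes "\<And>k. full (m k) (u k)" "\<And>k. u k + 1 / \<beta> ^ m k < 1"
  shows "\<exists>z\<in>{0..<1}. \<forall>k. \<forall>i<m k. digit z ((\<Sum>j<k. m j) + i) = digit (u k) i"
proof -
  define P where "P k = (\<Sum>j<k. m j)" for k
  define v where "v k = (\<Sum>j<k. u j / \<beta> ^ P j)" for k
  define r where "r k = v k + 1 / \<beta> ^ P k" for k
  have P: "P 0 = 0" "P (Suc k) = P k + m k" for k by (auto simp: P_def)
  have v: "v 0 = 0" "v (Suc k) = v k + u k / \<beta> ^ P k" for k by (auto simp: v_def)
  have full: "full (P k) (v k)" for k
    by (induction k) (auto simp: P v full_0 full_append(1)[OF _ assms(1)])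
  have u0: "0 \<le> u k" for k using full_left_endpoint[OF assms(1), of k] by simp
  have v_mono: "incseq v"
    by (rule incseq_SucI) (use u0 beta_pos in \<open>simp add: v\<close>)
  have r_Suc: "r (Suc k) < r k" for k
  proof -
    have "r (Suc k) = v k + (u k + 1 / \<beta> ^ m k) / \<beta> ^ P k"
      by (simp add: r_def P v power_add add_divide_distrib mult.commute)
    also have "\<dots> < r k"
      unfolding r_def using assms(2)[of k] beta_pow_pos[of "P k"]
      by (simp add: divide_strict_right_mono)
    finally show ?thesis .
  qed
  have r_mono: "decseq r" by (rule decseq_SucI) (use r_Suc less_imp_le in blast)
  have vr: "v j \<le> r k" for j k
  proof -
    have "v j \<le> v (max j k)" using v_mono by (simp add: incseq_def)
    also have "\<dots> \<le> r (max j k)" using beta_pow_pos[of "P (max j k)"] by (simp add: r_def)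
    also have "\<dots> \<le> r k" using r_mono by (simp add: decseq_def)
    finally show ?thesis .
  qed
  define z where "z = (SUP k. v k)"
  have bdd: "bdd_above (range v)" using vr[of _ 0] by (intro bdd_aboveI2)
  have zl: "v k \<le> z" for k unfolding z_def by (rule cSUP_upper[OF _ bdd]) simp
  have zr: "z < r k" for k
  proof -
    have "z \<le> r (Suc k)" unfolding z_def using vr by (intro cSUP_least) auto
    then show ?thesis using r_Suc[of k] by linarith
  qed
  define t where "t k = (z - v k) * \<beta> ^ P k" for k
  have t: "t k \<in> {0..<1}" for k
  proof -
    have "z - v k < 1 / \<beta> ^ P k" using zr[of k] by (simp add: r_def)
    then have "t k < 1" unfolding t_def using beta_pow_pos[of "P k"] by (simp only: pos_less_divide_eq)
    then show ?thesis using zl[of k] beta_pow_pos[of "P k"] by (simp add: t_def)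
  qed
  have zt: "z = v k + t k / \<beta> ^ P k" for k
    using beta_pos by (simp add: t_def)
  have "digit z (P k + i) = digit (u k) i" if "i < m k" for k i
  proof -
    have "digit z (P k + i) = digit (v (Suc k)) (P k + i)"
      using fullD(3)[OF full t, of "P k + i" "Suc k"] zt[of "Suc k"] that by (simp add: P)
    also have "\<dots> = digit (u k) i"
      using full_append(3)[OF full assms(1) that] by (simp add: v)
    finally show ?thesis .
  qed
  moreover have "z \<in> {0..<1}" using fullD(1)[OF full[of 0] t[of 0]] zt[of 0] by simp
  ultimately show ?thesis unfolding P_def by blast
qed

section \<open>Counting prefixes\<close>

definition prefix_cover :: "real set \<Rightarrow> nat \<Rightarrow> nat \<Rightarrow> bool" where
  "prefix_cover E n c \<longleftrightarrow>
     (\<exists>D. finite D \<and> card D \<le> c \<and> (\<forall>y\<in>E. \<exists>s\<in>D. \<forall>i<n. digit y i = s i))"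

lemma prefix_cover_0: "prefix_cover E 0 1"
  unfolding prefix_cover_def by (intro exI[of _ "{\<lambda>_. 0}"]) auto

text \<open>The factor counts the ways to deviate from the known word \<open>r\<close>: not at all,
  or by one of \<open>max_digit \<beta> + 1\<close> digits at one of \<open>l\<close>
  places.\<close>

lemma prefix_cover_extend:
  assumes "E \<subseteq> {0..<1}" "prefix_cover E n c"
    and "\<And>y. y \<in> E \<Longrightarrow> \<exists>j. \<forall>i<l. i \<noteq> j \<longrightarrow> digit y (n + i) = r i"
  shows "prefix_cover E (n + l) (c * (1 + l * (max_digit \<beta> + 1)))"
proof -
  from assms(2) obtain D where D: "finite D" "card D \<le> c" "\<forall>y\<in>E. \<exists>s\<in>D. \<forall>i<n. digit y i = s i"
    unfolding prefix_cover_def by blast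
  define A where "A = insert None (Some ` ({..<l} \<times> {..max_digit \<beta>}))"
  define F where "F = (\<lambda>(s, a) i. if i < n then s i else
    (case a of None \<Rightarrow> r (i - n) | Some (j, d) \<Rightarrow> (r(j := d)) (i - n)))"
  have A: "finite A" "card A = 1 + l * (max_digit \<beta> + 1)"
    by (auto simp: A_def card_insert_if card_image)
  have "finite (F ` (D \<times> A))" using D A by simp
  moreover have "card (F ` (D \<times> A)) \<le> c * (1 + l * (max_digit \<beta> + 1))"
  proof -
    have "card (F ` (D \<times> A)) \<le> card (D \<times> A)" using D A by (intro card_image_le) simp
    also have "\<dots> = card D * card A" by (rule card_cartesian_product)
    also have "\<dots> \<le> c * card A" using D(2) by (rule mult_right_mono) simp
    finally show ?thesis unfolding A(2) .
  qed
  moreover have "\<exists>s\<in>F ` (D \<times> A). \<forall>i<n + l. digit y i = s i" if y: "y \<in> E" for y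
  proof -
    obtain s where s: "s \<in> D" "\<forall>i<n. digit y i = s i" using D(3) y by blast
    obtain j where j: "\<forall>i<l. i \<noteq> j \<longrightarrow> digit y (n + i) = r i" using assms(3)[OF y] by blast
    have y01: "y \<in> {0..<1}" using assms(1) y by blast
    \<comment> \<open>An exceptional place outside the block means no deviation and is encoded by
      \<open>None\<close>.\<close>
    define a where "a = (if j < l then Some (j, digit y (n + j)) else None)"
    have "a \<in> A" unfolding a_def A_def using expansion_eq_digit(2)[OF y01] by auto
    moreover have "digit y i = F (s, a) i" if "i < n + l" for i
    proof (cases "i < n")
      case True
      then show ?thesis using s by (simp add: F_def)
    next
      case False
      then obtain k where "i = n + k" using le_Suc_ex[of n i] by auto
      then have k: "i = n + k" "k < l" using that by auto
      show ?thesis using j k by (auto simp: F_def a_def)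
    qed
    ultimately show ?thesis using s(1) by blast
  qed
  ultimately show ?thesis unfolding prefix_cover_def by blast
qed

text \<open>Points with a common word of length \<open>n\<close> lie within
  \<open>\<beta>^-n\<close> of any one of them, so each word costs an interval of twice that length.
  Outer measure is taken because the sets to which this is applied are not shown to be
  measurable.\<close>

lemma outer_measure_prefix_cover:
  assumes "E \<subseteq> {0..<1}" "prefix_cover E n c"
  shows "outer_measure_of lborel E \<le> ennreal (2 * real c / \<beta> ^ n)"
proof -
  from assms(2) obtain D where D: "finite D" "card D \<le> c" "\<forall>y\<in>E. \<exists>s\<in>D. \<forall>i<n. digit y i = s i"
    unfolding prefix_cover_def by blast
  define a where "a s = (SOME y. y \<in> E \<and> (\<forall>i<n. digit y i = s i))" for s
  define U where "U s = {a s - 1 / \<beta> ^ n .. a s + 1 / \<beta> ^ n}" for s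
  have sub: "E \<subseteq> (\<Union>s\<in>D. U s)"
  proof
    fix y assume y: "y \<in> E"
    then obtain s where s: "s \<in> D" "\<forall>i<n. digit y i = s i" using D(3) by blast
    have a: "a s \<in> E \<and> (\<forall>i<n. digit (a s) i = s i)"
      unfolding a_def by (rule someI[of _ y]) (use y s in blast)
    have "\<bar>y - a s\<bar> \<le> 1 / \<beta> ^ n"
    proof (rule dist_le_of_same_digits)
      show "y \<in> {0..<1}" "a s \<in> {0..<1}" using y a assms(1) by blast+
      show "\<forall>k<n. digit y k = digit (a s) k" using a s(2) by simp
    qed
    then have "y \<in> U s" unfolding U_def by (auto simp: abs_le_iff)
    then show "y \<in> (\<Union>s\<in>D. U s)" using s(1) by blast
  qed
  have "outer_measure_of lborel E \<le> outer_measure_of lborel (\<Union>s\<in>D. U s)"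
    using sub by (rule outer_measure_of_mono)
  also have "\<dots> = emeasure lborel (\<Union>s\<in>D. U s)"
    by (rule outer_measure_of_eq) (use D(1) in \<open>auto simp: U_def\<close>)
  also have "\<dots> \<le> (\<Sum>s\<in>D. emeasure lborel (U s))"
    by (rule emeasure_subadditive_finite) (use D(1) in \<open>auto simp: U_def\<close>)
  also have "\<dots> = (\<Sum>s\<in>D. ennreal (2 / \<beta> ^ n))"
    using beta_pow_pos[of n] by (intro sum.cong) (auto simp: U_def)
  also have "\<dots> = ennreal (real (card D) * (2 / \<beta> ^ n))"
    using beta_pow_pos[of n] by (subst sum_ennreal) auto
  also have "\<dots> \<le> ennreal (2 * real c / \<beta> ^ n)"
    using D(2) beta_pow_pos[of n] by (intro ennreal_leI) (simp add: divide_right_mono)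
  finally show ?thesis .
qed

section \<open>Birkhoff sums\<close>

definition bsum :: "(real \<Rightarrow> real) \<Rightarrow> nat \<Rightarrow> real \<Rightarrow> real" where
  "bsum \<psi> n x = (\<Sum>i<n. \<psi> ((T ^^ i) x))"

lemma bsum_add: "bsum \<psi> (m + n) x = bsum \<psi> m x + bsum \<psi> n ((T ^^ m) x)"
proof (induction n)
  case (Suc n)
  have "(T ^^ (m + n)) x = (T ^^ n) ((T ^^ m) x)" by (simp add: funpow_add add.commute[of m n])
  then show ?case using Suc by (simp add: bsum_def)
qed (simp add: bsum_def)

text \<open>
  Observables on the interval and on the shift are treated uniformly as functions on \<open>[0,1)\<close>
  that are uniformly continuous with respect to the digit metric.
\<close>

definition digit_continuous :: "(real \<Rightarrow> real) \<Rightarrow> bool" where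
  "digit_continuous \<psi> \<longleftrightarrow> (\<forall>\<eta>>0. \<exists>m. \<forall>x\<in>{0..<1}. \<forall>y\<in>{0..<1}.
     (\<forall>k<m. digit x k = digit y k) \<longrightarrow> \<bar>\<psi> x - \<psi> y\<bar> < \<eta>)"

lemma bsum_bounded:
  assumes "\<And>x. x \<in> {0..<1} \<Longrightarrow> \<bar>\<psi> x\<bar> \<le> M" "x \<in> {0..<1}"
  shows "\<bar>bsum \<psi> n x\<bar> \<le> real n * M"
proof -
  have "\<bar>bsum \<psi> n x\<bar> \<le> (\<Sum>i<n. \<bar>\<psi> ((T ^^ i) x)\<bar>)" unfolding bsum_def by (rule sum_abs)
  also have "\<dots> \<le> (\<Sum>i<n. M)" using iterate_in[OF assms(2)] assms(1) by (intro sum_mono) blast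
  finally show ?thesis by simp
qed

text \<open>Up to \<open>\<eta>\<close>, the term at time \<open>i\<close> depends only on the
  \<open>m\<close> digits from place \<open>i\<close> on. At most \<open>2 * m\<close> such windows
  contain the place \<open>j\<close> or run beyond \<open>n\<close>, and each of them costs at most
  \<open>2 * M\<close>; so \<open>C\<close> can be chosen independent of \<open>n\<close> and
  \<open>j\<close>.\<close>

lemma bsum_almost_same_digits:
  assumes bdd: "\<And>x. x \<in> {0..<1} \<Longrightarrow> \<bar>\<psi> x\<bar> \<le> M" and "digit_continuous \<psi>" "\<eta> > 0"
  shows "\<exists>C. \<forall>n. \<forall>x\<in>{0..<1}. \<forall>y\<in>{0..<1}. \<forall>j. (\<forall>k<n. k \<noteq> j \<longrightarrow> digit x k = digit y k) \<longrightarrow>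
     \<bar>bsum \<psi> n x - bsum \<psi> n y\<bar> \<le> real n * \<eta> + C"
proof -
  obtain m where m: "\<And>x y. x \<in> {0..<1} \<Longrightarrow> y \<in> {0..<1} \<Longrightarrow> (\<forall>k<m. digit x k = digit y k) \<Longrightarrow>
      \<bar>\<psi> x - \<psi> y\<bar> < \<eta>"
    using assms(2,3) unfolding digit_continuous_def by meson
  have M0: "0 \<le> M" using bdd[of 0] by simp
  have "\<bar>bsum \<psi> n x - bsum \<psi> n y\<bar> \<le> real n * \<eta> + 4 * M * real m"
    if x: "x \<in> {0..<1}" and y: "y \<in> {0..<1}" and j: "\<forall>k<n. k \<noteq> j \<longrightarrow> digit x k = digit y k"
    for n x y j
  proof -
    \<comment> \<open>The times whose window runs beyond \<open>n\<close>, and those whose window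
      contains \<open>j\<close>.\<close>
    define B where "B = {n - m..<n} \<union> {j + 1 - m..<j + 1}"
    have B: "finite B" "card B \<le> 2 * m"
    proof -
      have "card B \<le> card {n - m..<n} + card {j + 1 - m..<j + 1}" unfolding B_def by (rule card_Un_le)
      then show "card B \<le> 2 * m" by simp
    qed (simp add: B_def)
    have le: "\<bar>\<psi> ((T ^^ i) x) - \<psi> ((T ^^ i) y)\<bar> \<le> \<eta> + (if i \<in> B then 2 * M else 0)"
      if i: "i < n" for i
    proof (cases "i \<in> B")
      case True
      then show ?thesis
        using bdd[OF iterate_in[OF x, of i]] bdd[OF iterate_in[OF y, of i]] assms(3) by auto
    next
      case False
      have "digit ((T ^^ i) x) k = digit ((T ^^ i) y) k" if "k < m" for k
      proof -
        have "i + k < n" "i + k \<noteq> j" using False i that by (auto simp: B_def)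
        then show ?thesis using j by (simp add: digit_iterate)
      qed
      then have "\<bar>\<psi> ((T ^^ i) x) - \<psi> ((T ^^ i) y)\<bar> < \<eta>"
        using m[OF iterate_in[OF x] iterate_in[OF y]] by blast
      then show ?thesis using False by simp
    qed
    have "\<bar>bsum \<psi> n x - bsum \<psi> n y\<bar> \<le> (\<Sum>i<n. \<bar>\<psi> ((T ^^ i) x) - \<psi> ((T ^^ i) y)\<bar>)"
      unfolding bsum_def sum_subtractf[symmetric] by (rule sum_abs)
    also have "\<dots> \<le> (\<Sum>i<n. \<eta> + (if i \<in> B then 2 * M else 0))"
      using le by (intro sum_mono) simp
    also have "\<dots> = real n * \<eta> + real (card ({..<n} \<inter> B)) * (2 * M)"
      by (simp add: sum.distrib sum.If_cases Int_def)
    also have "\<dots> \<le> real n * \<eta> + real (2 * m) * (2 * M)"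
    proof -
      have "card ({..<n} \<inter> B) \<le> card B" using B(1) by (intro card_mono) auto
      then have "real (card ({..<n} \<inter> B)) \<le> real (2 * m)" using B(2) by linarith
      then have "real (card ({..<n} \<inter> B)) * (2 * M) \<le> real (2 * m) * (2 * M)"
        using M0 by (intro mult_right_mono) auto
      then show ?thesis by simp
    qed
    finally show ?thesis by (simp add: mult_ac)
  qed
  then show ?thesis by blast
qed

end


section \<open>Splicing orbit segments\<close>

locale splicing = beta_transformation +
  fixes q :: nat and l :: "nat \<Rightarrow> nat" and p :: "nat \<Rightarrow> real"
  assumes q_pos: "q > 0" and l_pos: "\<And>k. l k > 0" and p_in: "\<And>k. p k \<in> {0..<1}"
begin

text \<open>The positions at which stage \<open>k\<close> begins: \<open>src\<close> in the
  expansion of y, \<open>dst\<close> in the spliced one.\<close>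

definition src :: "nat \<Rightarrow> nat" where "src k = (\<Sum>j<k. q * l j)"

definition dst :: "nat \<Rightarrow> nat" where "dst k = (\<Sum>j<k. q * l j + l j)"

text \<open>A relation, since the changed digits are left open: the existence proof selects them,
  while the measure estimate must allow for all of them. A place \<open>j\<close> outside the block
  stands for no change.\<close>

definition spliced :: "real \<Rightarrow> real \<Rightarrow> bool" where
  "spliced y z \<longleftrightarrow> (\<forall>k. (\<exists>j. \<forall>i<q * l k. i \<noteq> j \<longrightarrow> digit z (dst k + i) = digit y (src k + i)) \<and>
     (\<exists>j. \<forall>i<l k. i \<noteq> j \<longrightarrow> digit z (dst k + q * l k + i) = digit (p k) i))"

lemma src_0 [simp]: "src 0 = 0" and src_Suc: "src (Suc k) = src k + q * l k"
  and dst_0 [simp]: "dst 0 = 0" and dst_Suc: "dst (Suc k) = dst k + q * l k + l k"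
  by (simp_all add: src_def dst_def)

text \<open>At stage boundaries the digits taken from y have density exactly q/(q + 1).\<close>

lemma src_dst: "q * dst k = (q + 1) * src k"
  by (induction k) (auto simp: src_Suc dst_Suc algebra_simps)

lemma src_le_dst: "src k \<le> dst k"
  by (induction k) (auto simp: src_Suc dst_Suc)

lemma strict_mono_src: "strict_mono src"
  by (rule strict_monoI_Suc) (use q_pos l_pos in \<open>simp add: src_Suc\<close>)

lemma strict_mono_dst: "strict_mono dst"
  by (rule strict_monoI_Suc) (use l_pos in \<open>simp add: dst_Suc\<close>)

text \<open>The two parts of a stage are made full separately, which is why each of them has its own
  changed digit.\<close>

lemma splice_exists:
  assumes y: "y \<in> {0..<1}"
  shows "\<exists>z\<in>{0..<1}. spliced y z"
proof -
  have "\<exists>v. full (q * l k) v \<and> (\<exists>j. \<forall>i<q * l k. i \<noteq> j \<longrightarrow> digit v i = digit y (src k + i))" for k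
    using full_modification[OF iterate_in[OF y, of "src k"], of "q * l k"]
    by (auto simp: digit_iterate)
  then obtain v where v: "\<And>k. full (q * l k) (v k)"
    "\<And>k. \<exists>j. \<forall>i<q * l k. i \<noteq> j \<longrightarrow> digit (v k) i = digit y (src k + i)" by metis
  have "\<exists>w. full (l k) w \<and> w + 1 / \<beta> ^ l k < 1 \<and> (\<exists>j. \<forall>i<l k. i \<noteq> j \<longrightarrow> digit w i = digit (p k) i)" for k
    using full_modification[OF p_in, of "l k" k] l_pos[of k] by auto
  then obtain w where w: "\<And>k. full (l k) (w k)" "\<And>k. w k + 1 / \<beta> ^ l k < 1"
    "\<And>k. \<exists>j. \<forall>i<l k. i \<noteq> j \<longrightarrow> digit (w k) i = digit (p k) i" by metis
  define u where "u k = v k + w k / \<beta> ^ (q * l k)" for k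
  have u: "full (q * l k + l k) (u k)" "\<And>i. i < q * l k \<Longrightarrow> digit (u k) i = digit (v k) i"
    "\<And>i. i < l k \<Longrightarrow> digit (u k) (q * l k + i) = digit (w k) i" for k
    unfolding u_def using full_append[OF v(1) w(1)] by blast+
  \<comment> \<open>The strict endpoint bound of the inserted word passes to the whole stage, as
    \<open>full_concatenation\<close> requires.\<close>
  have "u k + 1 / \<beta> ^ (q * l k + l k) < 1" for k
  proof -
    have "u k + 1 / \<beta> ^ (q * l k + l k) = v k + (w k + 1 / \<beta> ^ l k) / \<beta> ^ (q * l k)"
      by (simp add: u_def power_add add_divide_distrib mult.commute)
    also have "\<dots> < v k + 1 / \<beta> ^ (q * l k)"
      using w(2)[of k] beta_pow_pos[of "q * l k"] by (simp add: divide_strict_right_mono)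
    also have "\<dots> \<le> 1" by (rule full_right_endpoint[OF v(1)])
    finally show ?thesis .
  qed
  from full_concatenation[where m = "\<lambda>k. q * l k + l k", OF u(1) this] obtain z where z: "z \<in> {0..<1}"
    "\<And>k i. i < q * l k + l k \<Longrightarrow> digit z (dst k + i) = digit (u k) i"
    unfolding dst_def by blast
  have "spliced y z"
    unfolding spliced_def
  proof (intro allI conjI)
    fix k
    show "\<exists>j. \<forall>i<q * l k. i \<noteq> j \<longrightarrow> digit z (dst k + i) = digit y (src k + i)"
      using v(2)[of k] z(2)[of _ k] u(2)[of _ k] by simp
    have "digit z (dst k + q * l k + i) = digit (w k) i" if "i < l k" for i
      using z(2)[of "q * l k + i" k] u(3)[OF that] that by (simp add: add.assoc)
    then show "\<exists>j. \<forall>i<l k. i \<noteq> j \<longrightarrow> digit z (dst k + q * l k + i) = digit (p k) i"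
      using w(3)[of k] by simp
  qed
  then show ?thesis using z(1) by blast
qed

text \<open>
  Up to an error that is negligible against \<open>l k\<close>, the sums over the first \<open>dst (k + 1)\<close> terms at
  \<open>z\<close> and the first \<open>src (k + 1)\<close> terms at \<open>y\<close> differ by the sum over the inserted block.
\<close>

lemma splice_averages:
  assumes bdd: "\<And>x. x \<in> {0..<1} \<Longrightarrow> \<bar>\<psi> x\<bar> \<le> M" and cont: "digit_continuous \<psi>"
    and growth: "\<And>k. k * Suc (dst k) \<le> l k"
    and y: "y \<in> {0..<1}" and z: "z \<in> {0..<1}" and "spliced y z"
    and conv_y: "convergent (\<lambda>n. bsum \<psi> n y / real n)"
    and conv_z: "convergent (\<lambda>n. bsum \<psi> n z / real n)"
  shows "convergent (\<lambda>k. bsum \<psi> (l k) (p k) / real (l k))"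
proof -
  define e where "e k = bsum \<psi> (dst (Suc k)) z - bsum \<psi> (src (Suc k)) y - bsum \<psi> (l k) (p k)" for k
  have M0: "0 \<le> M" using bdd[of 0] by simp
  \<comment> \<open>The growth of \<open>l\<close> makes everything before stage \<open>k\<close>
    negligible against one inserted word.\<close>
  have dl: "real (dst k) / real (l k) \<le> 1 / real k" if "k > 0" for k
  proof -
    have "k * dst k \<le> l k" using growth[of k] by simp
    then have "real k * real (dst k) \<le> real (l k)" by (metis of_nat_le_iff of_nat_mult)
    then show ?thesis using that l_pos[of k] by (simp add: field_simps)
  qed
  have inv: "(\<lambda>k. 1 / real k) \<longlonglongrightarrow> 0" using lim_1_over_n by simp
  have dst_lim: "(\<lambda>k. real (dst k) / real (l k)) \<longlonglongrightarrow> 0"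
    by (rule tendsto_sandwich[OF _ _ tendsto_const inv])
      (use dl in \<open>auto intro!: eventually_sequentiallyI[of 1]\<close>)
  have src_lim: "(\<lambda>k. real (src k) / real (l k)) \<longlonglongrightarrow> 0"
    by (rule tendsto_sandwich[OF _ _ tendsto_const dst_lim])
      (use src_le_dst in \<open>auto intro!: always_eventually divide_right_mono\<close>)
  have l_lim: "(\<lambda>k. 1 / real (l k)) \<longlonglongrightarrow> 0"
  proof (rule tendsto_sandwich[OF _ _ tendsto_const inv])
    have "1 / real (l k) \<le> 1 / real k" if "k \<ge> 1" for k
      using growth[of k] that l_pos[of k] by (intro divide_left_mono) auto
    then show "\<forall>\<^sub>F k in sequentially. 1 / real (l k) \<le> 1 / real k"
      by (auto intro!: eventually_sequentiallyI[of 1])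
  qed auto
  have e_lim: "(\<lambda>k. e k / real (l k)) \<longlonglongrightarrow> 0"
  proof (rule LIMSEQ_I)
    fix r :: real assume r: "r > 0"
    \<comment> \<open>The two parts of stage \<open>k\<close> have total length
      \<open>(q + 1) * l k\<close>, so an error \<open>\<eta>\<close> per term amounts to
      \<open>r / 2\<close> relative to \<open>l k\<close>.\<close>
    define \<eta> where "\<eta> = r / 2 / (real q + 1)"
    have \<eta>: "\<eta> > 0" using r by (simp add: \<eta>_def)
    obtain C where C: "\<And>n x y j. x \<in> {0..<1} \<Longrightarrow> y \<in> {0..<1} \<Longrightarrow>
        (\<forall>k<n. k \<noteq> j \<longrightarrow> digit x k = digit y k) \<Longrightarrow>
        \<bar>bsum \<psi> n x - bsum \<psi> n y\<bar> \<le> real n * \<eta> + C"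
      using bsum_almost_same_digits[OF bdd cont \<eta>] by blast
    have e_le: "\<bar>e k\<bar> / real (l k) \<le> 2 * M * (real (dst k) / real (l k)) + r / 2 + 2 * C * (1 / real (l k))" for k
    proof -
      obtain j where j: "\<forall>i<q * l k. i \<noteq> j \<longrightarrow> digit z (dst k + i) = digit y (src k + i)"
        using \<open>spliced y z\<close> unfolding spliced_def by blast
      obtain j' where j': "\<forall>i<l k. i \<noteq> j' \<longrightarrow> digit z (dst k + q * l k + i) = digit (p k) i"
        using \<open>spliced y z\<close> unfolding spliced_def by blast
      have 1: "\<bar>bsum \<psi> (q * l k) ((T ^^ dst k) z) - bsum \<psi> (q * l k) ((T ^^ src k) y)\<bar>
          \<le> real (q * l k) * \<eta> + C"
        by (rule C[OF iterate_in[OF z] iterate_in[OF y], where j = j]) (use j in \<open>simp add: digit_iterate\<close>)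
      have 2: "\<bar>bsum \<psi> (l k) ((T ^^ (dst k + q * l k)) z) - bsum \<psi> (l k) (p k)\<bar> \<le> real (l k) * \<eta> + C"
        by (rule C[OF iterate_in[OF z] p_in, where j = j']) (use j' in \<open>simp add: digit_iterate\<close>)
      have 3: "\<bar>bsum \<psi> (dst k) z\<bar> \<le> real (dst k) * M" by (rule bsum_bounded[OF bdd z])
      have 4: "\<bar>bsum \<psi> (src k) y\<bar> \<le> real (dst k) * M"
      proof -
        have "\<bar>bsum \<psi> (src k) y\<bar> \<le> real (src k) * M" by (rule bsum_bounded[OF bdd y])
        also have "\<dots> \<le> real (dst k) * M" using src_le_dst[of k] M0 by (intro mult_right_mono) auto
        finally show ?thesis .
      qed
      have "e k = bsum \<psi> (dst k) z - bsum \<psi> (src k) y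
          + (bsum \<psi> (q * l k) ((T ^^ dst k) z) - bsum \<psi> (q * l k) ((T ^^ src k) y))
          + (bsum \<psi> (l k) ((T ^^ (dst k + q * l k)) z) - bsum \<psi> (l k) (p k))"
        unfolding e_def dst_Suc src_Suc bsum_add by simp
      then have "\<bar>e k\<bar> \<le> 2 * M * real (dst k) + (real (q * l k) * \<eta> + real (l k) * \<eta>) + 2 * C"
        using 1 2 3 4 by (simp add: mult_ac)
      also have "real (q * l k) * \<eta> + real (l k) * \<eta> = real (l k) * (r / 2)"
      proof -
        have "real (q * l k) * \<eta> + real (l k) * \<eta> = real (l k) * ((real q + 1) * \<eta>)"
          by (simp add: algebra_simps)
        also have "(real q + 1) * \<eta> = r / 2"
        proof -
          have "real q + 1 \<noteq> 0" by linarith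
          then show ?thesis by (metis \<eta>_def mult.commute nonzero_eq_divide_eq)
        qed
        finally show ?thesis .
      qed
      finally have "\<bar>e k\<bar> / real (l k)
          \<le> (2 * M * real (dst k) + real (l k) * (r / 2) + 2 * C) / real (l k)"
        by (rule divide_right_mono) simp
      also have "\<dots> = 2 * M * (real (dst k) / real (l k)) + r / 2 + 2 * C * (1 / real (l k))"
        using l_pos[of k] by (simp add: add_divide_distrib)
      finally show ?thesis .
    qed
    have "(\<lambda>k. 2 * M * (real (dst k) / real (l k)) + r / 2 + 2 * C * (1 / real (l k)))
        \<longlonglongrightarrow> 2 * M * 0 + r / 2 + 2 * C * 0"
      by (intro tendsto_intros dst_lim l_lim)
    then have "\<forall>\<^sub>F k in sequentially.
        2 * M * (real (dst k) / real (l k)) + r / 2 + 2 * C * (1 / real (l k)) < r"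
      by (rule order_tendstoD) (use r in simp)
    then obtain N where N: "\<And>k. k \<ge> N \<Longrightarrow>
        2 * M * (real (dst k) / real (l k)) + r / 2 + 2 * C * (1 / real (l k)) < r"
      unfolding eventually_sequentially by blast
    show "\<exists>N. \<forall>k\<ge>N. norm (e k / real (l k) - 0) < r"
    proof (intro exI allI impI)
      fix k assume "k \<ge> N"
      then show "norm (e k / real (l k) - 0) < r"
        using e_le[of k] N[of k] by (simp add: abs_divide)
    qed
  qed
  obtain c c' where c: "(\<lambda>n. bsum \<psi> n y / real n) \<longlonglongrightarrow> c" and c': "(\<lambda>n. bsum \<psi> n z / real n) \<longlonglongrightarrow> c'"
    using conv_y conv_z unfolding convergent_def by blast
  have sub: "strict_mono (\<lambda>k. src (Suc k))" "strict_mono (\<lambda>k. dst (Suc k))"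
    using strict_mono_src strict_mono_dst by (auto simp: strict_mono_def)
  have 1: "(\<lambda>k. bsum \<psi> (src (Suc k)) y / real (src (Suc k))) \<longlonglongrightarrow> c"
    using LIMSEQ_subseq_LIMSEQ[OF c sub(1)] by (simp add: o_def)
  have 2: "(\<lambda>k. bsum \<psi> (dst (Suc k)) z / real (dst (Suc k))) \<longlonglongrightarrow> c'"
    using LIMSEQ_subseq_LIMSEQ[OF c' sub(2)] by (simp add: o_def)
  have 3: "(\<lambda>k. real (src (Suc k)) / real (l k)) \<longlonglongrightarrow> 0 + real q"
  proof -
    have "real (src (Suc k)) / real (l k) = real (src k) / real (l k) + real q" for k
      using l_pos[of k] by (simp add: src_Suc add_divide_distrib)
    then show ?thesis by (simp only:) (intro tendsto_add src_lim tendsto_const)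
  qed
  have 4: "(\<lambda>k. real (dst (Suc k)) / real (l k)) \<longlonglongrightarrow> 0 + (real q + 1)"
  proof -
    have "real (dst (Suc k)) / real (l k) = real (dst k) / real (l k) + (real q + 1)" for k
      using l_pos[of k] by (simp add: dst_Suc add_divide_distrib)
    then show ?thesis by (simp only:) (intro tendsto_add dst_lim tendsto_const)
  qed
  \<comment> \<open>The definition of \<open>e\<close> solved for the inserted block. The averages
    along \<open>z\<close> and \<open>y\<close> converge by assumption and the length ratios tend to
    q + 1 and q, so the right-hand side converges.\<close>
  have eq: "bsum \<psi> (l k) (p k) / real (l k) =
      bsum \<psi> (dst (Suc k)) z / real (dst (Suc k)) * (real (dst (Suc k)) / real (l k))
      - bsum \<psi> (src (Suc k)) y / real (src (Suc k)) * (real (src (Suc k)) / real (l k))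
      - e k / real (l k)" for k
  proof -
    have "dst (Suc k) > 0" "src (Suc k) > 0" using l_pos[of k] q_pos by (simp_all add: src_Suc dst_Suc)
    then have "bsum \<psi> (dst (Suc k)) z / real (dst (Suc k)) * (real (dst (Suc k)) / real (l k))
        = bsum \<psi> (dst (Suc k)) z / real (l k)"
      "bsum \<psi> (src (Suc k)) y / real (src (Suc k)) * (real (src (Suc k)) / real (l k))
        = bsum \<psi> (src (Suc k)) y / real (l k)" by simp_all
    then show ?thesis unfolding e_def by (simp only: diff_divide_distrib)
  qed
  have "(\<lambda>k. bsum \<psi> (l k) (p k) / real (l k)) \<longlonglongrightarrow> c' * (0 + (real q + 1)) - c * (0 + real q) - 0"
    unfolding eq by (intro tendsto_diff tendsto_mult 1 2 3 4 e_lim)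
  then show ?thesis unfolding convergent_def by blast
qed

text \<open>Assumption \<open>l_large\<close> pays for the repairs in a complete block with constant
  1, so that no constants multiply over the blocks; \<open>C\<close> is spent once, on the
  incomplete last block. The first \<open>N\<close> digits of z thus fix Y digits of y, with Y at
  least N q/(q + 1), up to \<open>C\<close> times \<open>\<beta>\<close> to the power Y/q
  choices.\<close>

lemma splice_outer_measure:
  assumes C: "C \<ge> 0" "\<And>n. 1 + real n * (real (max_digit \<beta>) + 1) \<le> C * \<beta> powr (real n / real q)"
    and l_large: "\<And>k. 1 + real (q * l k) * (real (max_digit \<beta>) + 1) \<le> \<beta> powr (real (q * l k) / real q)"
  shows "outer_measure_of lborel {y \<in> {0..<1}. \<exists>z. spliced y z \<and> (\<forall>k<N. digit z k = t k)}
    \<le> ennreal (2 * C * \<beta> powr (- ((real q - 1) / (real q + 1) * real N)))"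
proof -
  define E where "E = {y \<in> {0..<1}. \<exists>z. spliced y z \<and> (\<forall>k<N. digit z k = t k)}"
  have E: "E \<subseteq> {0..<1}" by (auto simp: E_def)
  have block: "\<exists>j. \<forall>i<n. i \<noteq> j \<longrightarrow> digit y (src k + i) = t (dst k + i)"
    if y: "y \<in> E" and n: "n \<le> q * l k" "dst k + n \<le> N" for n k y
  proof -
    obtain z where z: "spliced y z" "\<forall>k<N. digit z k = t k" using y by (auto simp: E_def)
    obtain j where j: "\<forall>i<q * l k. i \<noteq> j \<longrightarrow> digit z (dst k + i) = digit y (src k + i)"
      using z(1) unfolding spliced_def by blast
    have "digit y (src k + i) = t (dst k + i)" if "i < n" "i \<noteq> j" for i
      using j[rule_format, of i] z(2)[rule_format, of "dst k + i"] that n by simp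
    then show ?thesis by blast
  qed
  have full_blocks: "\<exists>c. prefix_cover E (src K) c \<and> real c \<le> \<beta> powr (real (src K) / real q)"
    if "dst K \<le> N" for K
    using that
  proof (induction K)
    case 0
    show ?case using prefix_cover_0 beta_pos by (intro exI[of _ 1]) auto
  next
    case (Suc K)
    then have le: "dst K + q * l K \<le> N" by (simp add: dst_Suc)
    then obtain c where c: "prefix_cover E (src K) c" "real c \<le> \<beta> powr (real (src K) / real q)"
      using Suc by auto
    have 1: "prefix_cover E (src (Suc K)) (c * (1 + q * l K * (max_digit \<beta> + 1)))"
      unfolding src_Suc by (rule prefix_cover_extend[OF E c(1) block]) (use le in auto)
    have 2: "real (c * (1 + q * l K * (max_digit \<beta> + 1)))
        \<le> \<beta> powr (real (src K) / real q) * \<beta> powr (real (q * l K) / real q)"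
    proof -
      have "real (c * (1 + q * l K * (max_digit \<beta> + 1))) =
          real c * (1 + real (q * l K) * (real (max_digit \<beta>) + 1))"
        by (simp add: algebra_simps)
      also have "\<dots> \<le> \<beta> powr (real (src K) / real q) * \<beta> powr (real (q * l K) / real q)"
        by (intro mult_mono c(2) l_large) auto
      finally show ?thesis .
    qed
    have 3: "\<beta> powr (real (src K) / real q) * \<beta> powr (real (q * l K) / real q)
        = \<beta> powr (real (src (Suc K)) / real q)"
      by (simp add: src_Suc powr_add[symmetric] add_divide_distrib del: of_nat_mult)
    show ?case using 1 2[unfolded 3] by blast
  qed
  \<comment> \<open>\<open>K\<close> counts the stages that are complete within the first
    \<open>N\<close> digits.\<close>
  obtain K where K: "dst K \<le> N" "N < dst (Suc K)"
  proof -
    have fin: "finite {k. dst k \<le> N}"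
      by (rule finite_subset[of _ "{..N}"]) (use strict_mono_imp_increasing[OF strict_mono_dst] in \<open>auto intro: le_trans\<close>)
    have 0: "0 \<in> {k. dst k \<le> N}" by simp
    let ?K = "Max {k. dst k \<le> N}"
    have "?K \<in> {k. dst k \<le> N}" using Max_in[OF fin] 0 by blast
    moreover have "Suc ?K \<notin> {k. dst k \<le> N}" using Max_ge[OF fin, of "Suc ?K"] by auto
    ultimately show ?thesis using that[of ?K] by auto
  qed
  from full_blocks[OF K(1)] obtain c where
    c: "prefix_cover E (src K) c" "real c \<le> \<beta> powr (real (src K) / real q)" by blast
  \<comment> \<open>The digits of y that can be read off from the incomplete stage; the minimum
    discards positions inside the inserted word.\<close>
  define n where "n = min (N - dst K) (q * l K)"
  define Y where "Y = src K + n"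
  have cov: "prefix_cover E Y (c * (1 + n * (max_digit \<beta> + 1)))"
    unfolding Y_def by (rule prefix_cover_extend[OF E c(1) block]) (use K(1) in \<open>auto simp: n_def\<close>)
  have count: "real (c * (1 + n * (max_digit \<beta> + 1))) \<le> C * \<beta> powr (real Y / real q)"
  proof -
    have "real (c * (1 + n * (max_digit \<beta> + 1))) = real c * (1 + real n * (real (max_digit \<beta>) + 1))"
      by (simp add: algebra_simps)
    also have "\<dots> \<le> \<beta> powr (real (src K) / real q) * (C * \<beta> powr (real n / real q))"
      by (intro mult_mono c(2) C(2)) auto
    also have "\<dots> = C * \<beta> powr (real Y / real q)"
      by (simp add: Y_def add_divide_distrib powr_add)
    finally show ?thesis .
  qed
  \<comment> \<open>Digits of y come first in a stage, so their share is never below q/(q + 1); the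
    extreme case is the end of the inserted word.\<close>
  have "q * (N - dst K) \<le> (q + 1) * n"
  proof (cases "N - dst K \<le> q * l K")
    case True
    then show ?thesis by (simp add: n_def)
  next
    case False
    then have "n = q * l K" by (simp add: n_def)
    moreover have "N - dst K \<le> (q + 1) * l K" using K by (simp add: dst_Suc)
    then have "q * (N - dst K) \<le> q * ((q + 1) * l K)" by (rule mult_left_mono) simp
    ultimately show ?thesis by (simp only: mult_ac)
  qed
  then have "q * dst K + q * (N - dst K) \<le> (q + 1) * Y"
    unfolding Y_def src_dst by (simp add: algebra_simps)
  then have "q * N \<le> (q + 1) * Y" using K(1) by (simp add: distrib_left[symmetric])
  then have NY: "real q * real N \<le> (real q + 1) * real Y"
    by (metis of_nat_le_iff of_nat_mult of_nat_add of_nat_1)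
  \<comment> \<open>About \<open>\<beta>\<close> to the power Y/q words, each of measure at most
    \<open>2 / \<beta> ^ Y\<close>, give the left exponent; \<open>NY\<close> converts it from Y to
    \<open>N\<close>.\<close>
  have expo: "real Y / real q - real Y \<le> - ((real q - 1) / (real q + 1) * real N)"
  proof -
    have q1: "real q \<ge> 1" using q_pos by linarith
    have "(real q - 1) / (real q + 1) * real N = ((real q - 1) / real q) * (real q * real N / (real q + 1))"
      using q1 by simp
    also have "\<dots> \<le> ((real q - 1) / real q) * real Y"
      using q1 NY by (intro mult_left_mono) (auto simp: field_simps)
    also have "\<dots> = real Y - real Y / real q" using q1 by (simp add: field_simps)
    finally show ?thesis by linarith
  qed
  have "outer_measure_of lborel E \<le> ennreal (2 * real (c * (1 + n * (max_digit \<beta> + 1))) / \<beta> ^ Y)"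
    by (rule outer_measure_prefix_cover[OF E cov])
  also have "\<dots> \<le> ennreal (2 * C * \<beta> powr (- ((real q - 1) / (real q + 1) * real N)))"
  proof (rule ennreal_leI)
    have "2 * real (c * (1 + n * (max_digit \<beta> + 1))) / \<beta> ^ Y
        \<le> 2 * (C * \<beta> powr (real Y / real q)) / \<beta> powr real Y"
      using count beta_pos by (simp add: powr_realpow divide_right_mono del: of_nat_mult of_nat_add)
    also have "\<dots> = 2 * C * \<beta> powr (real Y / real q - real Y)"
      by (simp add: powr_diff)
    also have "\<dots> \<le> 2 * C * \<beta> powr (- ((real q - 1) / (real q + 1) * real N))"
      using C(1) beta_gt_1 expo by (intro mult_left_mono powr_mono) auto
    finally show "2 * real (c * (1 + n * (max_digit \<beta> + 1))) / \<beta> ^ Y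
        \<le> 2 * C * \<beta> powr (- ((real q - 1) / (real q + 1) * real N))" .
  qed
  finally show ?thesis unfolding E_def .
qed

end

section \<open>Subadditivity of outer measure, and linear against exponential growth\<close>

lemma outer_measure_of_UN_le_infsum:
  fixes I :: "nat set"
  assumes "\<And>i. i \<in> I \<Longrightarrow> A i \<subseteq> space M"
  shows "outer_measure_of M (\<Union>i\<in>I. A i) \<le> (\<Sum>\<^sub>\<infinity>i\<in>I. outer_measure_of M (A i))"
proof -
  \<comment> \<open>Measurable hulls of equal outer measure reduce the claim to subadditivity of the
    measure.\<close>
  have "\<exists>E\<in>sets M. A i \<subseteq> E \<and> outer_measure_of M (A i) = emeasure M E" if "i \<in> I" for i
    by (rule outer_measure_of_attain[OF assms[OF that]])
  then obtain E where E: "\<And>i. i \<in> I \<Longrightarrow> E i \<in> sets M" "\<And>i. i \<in> I \<Longrightarrow> A i \<subseteq> E i"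
    "\<And>i. i \<in> I \<Longrightarrow> outer_measure_of M (A i) = emeasure M (E i)" by metis
  define F where "F i = (if i \<in> I then E i else {})" for i
  have F: "range F \<subseteq> sets M" using E(1) by (auto simp: F_def)
  have "outer_measure_of M (\<Union>i\<in>I. A i) \<le> outer_measure_of M (\<Union>i. F i)"
    using E(2) by (intro outer_measure_of_mono) (fastforce simp: F_def)
  also have "\<dots> = emeasure M (\<Union>i. F i)" using F by (intro outer_measure_of_eq) auto
  also have "\<dots> \<le> (\<Sum>i. emeasure M (F i))" by (rule emeasure_subadditive_countably[OF F])
  also have "\<dots> \<le> (\<Sum>\<^sub>\<infinity>i\<in>I. outer_measure_of M (A i))"
  proof (rule suminf_le_const)
    fix n
    have "(\<Sum>i<n. emeasure M (F i)) = (\<Sum>i\<in>{..<n} \<inter> I. outer_measure_of M (A i))"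
      by (rule sum.mono_neutral_cong_right) (auto simp: F_def E(3))
    also have "\<dots> = (\<Sum>\<^sub>\<infinity>i\<in>{..<n} \<inter> I. outer_measure_of M (A i))" by simp
    also have "\<dots> \<le> (\<Sum>\<^sub>\<infinity>i\<in>I. outer_measure_of M (A i))"
      by (rule infsum_mono_neutral) (auto intro: nonneg_summable_on_complete)
    finally show "(\<Sum>i<n. emeasure M (F i)) \<le> (\<Sum>\<^sub>\<infinity>i\<in>I. outer_measure_of M (A i))" .
  qed simp
  finally show ?thesis .
qed

lemma outer_measure_of_UN_le_sum:
  assumes "finite I" "\<And>i. i \<in> I \<Longrightarrow> A i \<subseteq> space M"
  shows "outer_measure_of M (\<Union>i\<in>I. A i) \<le> (\<Sum>i\<in>I. outer_measure_of M (A i))"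
proof -
  have "\<exists>E\<in>sets M. A i \<subseteq> E \<and> outer_measure_of M (A i) = emeasure M E" if "i \<in> I" for i
    by (rule outer_measure_of_attain[OF assms(2)[OF that]])
  then obtain E where E: "\<And>i. i \<in> I \<Longrightarrow> E i \<in> sets M" "\<And>i. i \<in> I \<Longrightarrow> A i \<subseteq> E i"
    "\<And>i. i \<in> I \<Longrightarrow> outer_measure_of M (A i) = emeasure M (E i)" by metis
  have "outer_measure_of M (\<Union>i\<in>I. A i) \<le> outer_measure_of M (\<Union>i\<in>I. E i)"
    using E(2) by (intro outer_measure_of_mono) fastforce
  also have "\<dots> = emeasure M (\<Union>i\<in>I. E i)" using E(1) assms(1) by (intro outer_measure_of_eq) auto
  also have "\<dots> \<le> (\<Sum>i\<in>I. emeasure M (E i))"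
    using E(1) assms(1) by (intro emeasure_subadditive_finite) auto
  also have "\<dots> = (\<Sum>i\<in>I. outer_measure_of M (A i))" using E(3) by simp
  finally show ?thesis .
qed

lemma outer_measure_of_Un_le:
  assumes "A \<subseteq> space M" "B \<subseteq> space M"
  shows "outer_measure_of M (A \<union> B) \<le> outer_measure_of M A + outer_measure_of M B"
  using outer_measure_of_UN_le_sum[of UNIV "\<lambda>b. if b then A else B" M] assms
  by (simp add: UN_bool_eq UNIV_bool add.commute Un_commute split: if_splits)

lemma infsum_cmult_right_ennreal:
  fixes f :: "'a \<Rightarrow> ennreal"
  assumes "c < top"
  shows "(\<Sum>\<^sub>\<infinity>i\<in>I. c * f i) = c * (\<Sum>\<^sub>\<infinity>i\<in>I. f i)"
proof (rule infsumI)
  have "(f has_sum (\<Sum>\<^sub>\<infinity>i\<in>I. f i)) I" by (intro has_sum_infsum nonneg_summable_on_complete) simp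
  then show "((\<lambda>i. c * f i) has_sum (c * (\<Sum>\<^sub>\<infinity>i\<in>I. f i))) I"
    unfolding has_sum_def sum_distrib_left[symmetric] by (rule ennreal_tendsto_cmult[OF assms])
qed

text \<open>The quotient of the two sides tends to 0. The first form serves complete blocks, whose
  length can be chosen large; the second serves blocks of any length and the word count in the
  interval.\<close>

lemma linear_le_powr:
  fixes d b r :: real
  assumes "b > 1" "r > 0"
  shows "\<exists>N. \<forall>n\<ge>N. 1 + real n * d \<le> b powr (real n * r)"
    and "\<exists>C\<ge>0. \<forall>n. 1 + real n * d \<le> C * b powr (real n * r)"
proof -
  define x where "x = b powr (- r)"
  have x: "0 < x" "x < 1" using assms by (auto simp: x_def powr_less_one)
  have xn: "x ^ n = 1 / b powr (real n * r)" for n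
  proof -
    have "x ^ n = b powr (- r * real n)" using x(1) by (simp add: x_def powr_realpow[symmetric] powr_powr)
    then show ?thesis by (simp add: powr_minus_divide mult.commute)
  qed
  have "(\<lambda>n. x ^ n + d * (real n * x ^ n)) \<longlonglongrightarrow> 0 + d * 0"
    using x by (intro tendsto_add tendsto_mult tendsto_const LIMSEQ_power_zero powser_times_n_limit_0) auto
  then have lim: "(\<lambda>n. (1 + real n * d) * x ^ n) \<longlonglongrightarrow> 0" by (simp add: algebra_simps)
  have le: "1 + real n * d \<le> C * b powr (real n * r)" if "(1 + real n * d) * x ^ n \<le> C" for n C
    using that assms by (simp add: xn pos_divide_le_eq)
  have "\<forall>\<^sub>F n in sequentially. (1 + real n * d) * x ^ n < 1"
    by (rule order_tendstoD(2)[OF lim]) simp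
  then show "\<exists>N. \<forall>n\<ge>N. 1 + real n * d \<le> b powr (real n * r)"
    unfolding eventually_sequentially using le[of _ 1] less_imp_le by (metis mult_1)
  have "Bseq (\<lambda>n. (1 + real n * d) * x ^ n)"
    using lim by (intro convergent_imp_Bseq convergentI)
  then obtain C where C: "C > 0" "\<And>n. norm ((1 + real n * d) * x ^ n) \<le> C" by (auto elim: BseqE)
  have "1 + real n * d \<le> C * b powr (real n * r)" for n
    by (rule le) (use C(2)[of n] in \<open>auto simp: abs_le_iff\<close>)
  then show "\<exists>C\<ge>0. \<forall>n. 1 + real n * d \<le> C * b powr (real n * r)" using C(1) by (intro exI[of _ C]) auto
qed

section \<open>The mass distribution on the irregular set\<close>

context beta_transformation
begin

text \<open>
  No ergodicity is needed: points with divergent averages are left unchanged by \<open>h\<close>, and all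
  others are spliced.
\<close>

lemma irregular_mass_distribution:
  assumes bdd: "\<And>x. x \<in> {0..<1} \<Longrightarrow> \<bar>\<psi> x\<bar> \<le> M" and cont: "digit_continuous \<psi>"
    and "a < b" and lo: "\<And>n0. \<exists>n\<ge>n0. \<exists>x\<in>{0..<1}. bsum \<psi> n x < a * real n"
    and hi: "\<And>n0. \<exists>n\<ge>n0. \<exists>x\<in>{0..<1}. bsum \<psi> n x > b * real n"
    and s: "0 < s" "s < 1"
  shows "\<exists>(h :: real \<Rightarrow> real) K. (\<forall>y\<in>{0..<1}. h y \<in> {0..<1} \<and> \<not> convergent (\<lambda>n. bsum \<psi> n (h y) / real n)) \<and>
    0 \<le> K \<and> (\<forall>N t. outer_measure_of lborel {y \<in> {0..<1}. \<forall>k<N. digit (h y) k = t k}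
       \<le> ennreal (K * \<beta> powr (- (s * real N))))"
proof -
  \<comment> \<open>Equivalent to \<open>s < (q - 1) / (q + 1)\<close>, the exponent in
    \<open>splice_outer_measure\<close>.\<close>
  obtain q :: nat where q: "real q > (1 + s) / (1 - s)" using reals_Archimedean2 by blast
  have "(1 + s) / (1 - s) > 0" using s by simp
  then have q_pos: "q > 0" using q by (metis less_trans of_nat_0_less_iff)
  have qs: "s \<le> (real q - 1) / (real q + 1)"
    using q s q_pos by (simp add: field_simps)
  let ?d = "real (max_digit \<beta>) + 1"
  have r: "1 / real q > 0" using q_pos by simp
  from linear_le_powr(1)[OF beta_gt_1 r, of ?d] obtain n1
    where n1: "\<And>n. n \<ge> n1 \<Longrightarrow> 1 + real n * ?d \<le> \<beta> powr (real n / real q)" by auto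
  from linear_le_powr(2)[OF beta_gt_1 r, of ?d] obtain C
    where C: "C \<ge> 0" "\<And>n. 1 + real n * ?d \<le> C * \<beta> powr (real n / real q)" by auto
  \<comment> \<open>The parity of the stage decides between a low and a high average, so the
    averages of the inserted words diverge.\<close>
  define good where "good k n x \<longleftrightarrow> x \<in> {0..<1} \<and>
    (if even k then bsum \<psi> n x < a * real n else bsum \<psi> n x > b * real n)" for k :: nat and n x
  have good: "\<exists>n\<ge>n0. \<exists>x. good k n x" for k n0
    using lo[of n0] hi[of n0] unfolding good_def Bex_def by (cases "even k") (simp_all only: if_True if_False)
  \<comment> \<open>The length chosen at stage \<open>k\<close> must dominate \<open>dst k\<close>,
    hence depends on all earlier lengths. The component \<open>S\<close> carries their sum, and
    \<open>(q + 1) * S\<close> will be \<open>dst k\<close>.\<close>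
  define P where "P k = (\<lambda>(n, x, S). good k n x \<and> n \<ge> Suc n1 \<and> k * Suc ((q + 1) * S) \<le> n \<and> (k = 0 \<longrightarrow> S = 0))"
    for k :: nat
  define Q where "Q = (\<lambda>k :: nat. \<lambda>(n, x :: real, S) (n' :: nat, x' :: real, S'). S' = S + (n :: nat))"
  have ex: "\<exists>c. P k c \<and> (case c of (n, x, S') \<Rightarrow> S' = S)" if "k = 0 \<longrightarrow> S = 0" for k S
  proof -
    obtain n x where "n \<ge> max (Suc n1) (k * Suc ((q + 1) * S))" "good k n x"
      using good by blast
    then show ?thesis using that by (intro exI[of _ "(n, x, S)"]) (auto simp: P_def)
  qed
  have "\<exists>f. \<forall>k. P k (f k) \<and> Q k (f k) (f (Suc k))"
  proof (rule dependent_nat_choice)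
    show "\<exists>c. P 0 c" using ex[of 0 0] by blast
    fix c :: "nat \<times> real \<times> nat" and k
    obtain n x S where c: "c = (n, x, S)" by (cases c)
    show "\<exists>c'. P (Suc k) c' \<and> Q k c c'" using ex[of "Suc k" "S + n"] unfolding c Q_def by fastforce
  qed
  then obtain f where f: "\<And>k. P k (f k)" "\<And>k. Q k (f k) (f (Suc k))" by blast
  define l where "l k = fst (f k)" for k
  define p where "p k = fst (snd (f k))" for k
  define S where "S k = snd (snd (f k))" for k
  have good_lp: "good k (l k) (p k)" and l_ge: "l k \<ge> Suc n1" and l_growth: "k * Suc ((q + 1) * S k) \<le> l k"
    and S0: "k = 0 \<longrightarrow> S k = 0" for k
    using f(1)[of k] by (auto simp: P_def l_def p_def S_def split: prod.splits)
  have S_Suc: "S (Suc k) = S k + l k" for k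
    using f(2)[of k] by (auto simp: Q_def l_def S_def split: prod.splits)
  have l_pos: "l k > 0" for k using l_ge[of k] by simp
  have p_in: "p k \<in> {0..<1}" for k using good_lp[of k] by (simp add: good_def)
  interpret splicing \<beta> q l p
    by unfold_locales (use q_pos l_pos p_in in auto)
  have dst_S: "dst k = (q + 1) * S k" for k
    by (induction k) (auto simp: S0 S_Suc dst_Suc algebra_simps)
  have growth: "k * Suc (dst k) \<le> l k" for k using l_growth[of k] by (simp add: dst_S)
  have not_conv: "\<not> convergent (\<lambda>k. bsum \<psi> (l k) (p k) / real (l k))"
  proof
    assume "convergent (\<lambda>k. bsum \<psi> (l k) (p k) / real (l k))"
    then obtain c where c: "(\<lambda>k. bsum \<psi> (l k) (p k) / real (l k)) \<longlonglongrightarrow> c" by (auto simp: convergent_def)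
    have lt: "bsum \<psi> (l (2 * k)) (p (2 * k)) / real (l (2 * k)) \<le> a" for k
      using good_lp[of "2 * k"] l_pos[of "2 * k"] by (simp add: good_def pos_divide_le_eq)
    have gt: "b \<le> bsum \<psi> (l (Suc (2 * k))) (p (Suc (2 * k))) / real (l (Suc (2 * k)))" for k
      using good_lp[of "Suc (2 * k)"] l_pos[of "Suc (2 * k)"] by (simp add: good_def pos_le_divide_eq)
    have "strict_mono (\<lambda>k :: nat. 2 * k)" "strict_mono (\<lambda>k :: nat. Suc (2 * k))"
      by (auto simp: strict_mono_def)
    note sub = LIMSEQ_subseq_LIMSEQ[OF c this(1)] LIMSEQ_subseq_LIMSEQ[OF c this(2)]
    have "c \<le> a" by (rule LIMSEQ_le_const2[OF sub(1)]) (use lt in auto)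
    moreover have "b \<le> c" by (rule LIMSEQ_le_const[OF sub(2)]) (use gt in auto)
    ultimately show False using \<open>a < b\<close> by simp
  qed
  define irr where "irr y \<longleftrightarrow> \<not> convergent (\<lambda>n. bsum \<psi> n y / real n)" for y
  \<comment> \<open>The spliced point is picked by choice, with no control of measurability in
    \<open>y\<close>.\<close>
  define h where "h y = (if irr y then y else SOME z. z \<in> {0..<1} \<and> spliced y z)" for y
  have h_splice: "h y \<in> {0..<1} \<and> spliced y (h y)" if "y \<in> {0..<1}" "\<not> irr y" for y
  proof -
    have "\<exists>z. z \<in> {0..<1} \<and> spliced y z" using splice_exists[OF that(1)] by blast
    from someI_ex[OF this] show "h y \<in> {0..<1} \<and> spliced y (h y)"
      using that(2) by (simp only: h_def if_False)
  qed
  show ?thesis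
  proof (intro exI[of _ h] exI[of _ "2 + 2 * C"] conjI ballI allI)
    fix y :: real assume y: "y \<in> {0..<1}"
    show "h y \<in> {0..<1}"
      using y h_splice[OF y] by (cases "irr y") (auto simp: h_def)
    show "\<not> convergent (\<lambda>n. bsum \<psi> n (h y) / real n)"
    proof (cases "irr y")
      case True
      then show ?thesis by (simp add: h_def irr_def)
    next
      case False
      then have conv: "convergent (\<lambda>n. bsum \<psi> n y / real n)" and z: "h y \<in> {0..<1}" "spliced y (h y)"
        using h_splice[OF y] by (simp_all add: irr_def)
      show ?thesis
      proof
        assume "convergent (\<lambda>n. bsum \<psi> n (h y) / real n)"
        from splice_averages[OF bdd cont growth y z conv this] not_conv show False by simp
      qed
    qed
  next
    show "0 \<le> 2 + 2 * C" using C(1) by simp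
  next
    fix N t
    \<comment> \<open>Either \<open>h y = y\<close>, and \<open>y\<close> itself has the prescribed
      word, or \<open>y\<close> is spliced; these cases give the summands 2 and \<open>2 * C\<close>
      of the constant.\<close>
    define X where "X = {y \<in> {0..<1}. \<forall>k<N. digit y k = t k}"
    define X' where "X' = {y \<in> {0..<1}. \<exists>z. spliced y z \<and> (\<forall>k<N. digit z k = t k)}"
    have "{y \<in> {0..<1}. \<forall>k<N. digit (h y) k = t k} \<subseteq> X \<union> X'"
    proof
      fix y assume "y \<in> {y \<in> {0..<1}. \<forall>k<N. digit (h y) k = t k}"
      then have y: "y \<in> {0..<1}" "\<forall>k<N. digit (h y) k = t k" by simp_all
      show "y \<in> X \<union> X'"
      proof (cases "irr y")
        case True
        then have "h y = y" by (simp add: h_def)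
        then show ?thesis using y by (simp add: X_def)
      next
        case False
        then have "spliced y (h y) \<and> (\<forall>k<N. digit (h y) k = t k)" using y(2) h_splice[OF y(1)] by simp
        then show ?thesis using y(1) unfolding X'_def by blast
      qed
    qed
    then have "outer_measure_of lborel {y \<in> {0..<1}. \<forall>k<N. digit (h y) k = t k}
        \<le> outer_measure_of lborel (X \<union> X')" by (rule outer_measure_of_mono)
    also have "\<dots> \<le> outer_measure_of lborel X + outer_measure_of lborel X'"
      by (rule outer_measure_of_Un_le) simp_all
    also have "\<dots> \<le> ennreal (2 * \<beta> powr (- (s * real N))) + ennreal (2 * C * \<beta> powr (- (s * real N)))"
    proof (rule add_mono)
      have "prefix_cover X N 1"
        unfolding prefix_cover_def X_def by (intro exI[of _ "{t}"]) simp
      moreover have "X \<subseteq> {0..<1}" by (auto simp: X_def)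
      ultimately have "outer_measure_of lborel X \<le> ennreal (2 * real 1 / \<beta> ^ N)"
        by (rule outer_measure_prefix_cover[rotated])
      also have "\<dots> \<le> ennreal (2 * \<beta> powr (- (s * real N)))"
      proof (rule ennreal_leI)
        have "2 * real 1 / \<beta> ^ N = 2 * \<beta> powr (- real N)"
          using beta_pos by (simp add: powr_minus_divide powr_realpow)
        also have "\<dots> \<le> 2 * \<beta> powr (- (s * real N))"
          using beta_gt_1 s by (intro mult_left_mono powr_mono) (auto simp: mult_left_le_one_le)
        finally show "2 * real 1 / \<beta> ^ N \<le> 2 * \<beta> powr (- (s * real N))" .
      qed
      finally show "outer_measure_of lborel X \<le> ennreal (2 * \<beta> powr (- (s * real N)))" .
      have "1 + real (q * l k) * ?d \<le> \<beta> powr (real (q * l k) / real q)" for k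
      proof (rule n1)
        have "n1 \<le> 1 * l k" using l_ge[of k] by simp
        also have "\<dots> \<le> q * l k" using q_pos by (intro mult_right_mono) auto
        finally show "n1 \<le> q * l k" .
      qed
      from splice_outer_measure[OF C this, of N t]
      have "outer_measure_of lborel X' \<le> ennreal (2 * C * \<beta> powr (- ((real q - 1) / (real q + 1) * real N)))"
        unfolding X'_def .
      also have "\<dots> \<le> ennreal (2 * C * \<beta> powr (- (s * real N)))"
      proof -
        have "s * real N \<le> (real q - 1) / (real q + 1) * real N" using qs by (rule mult_right_mono) simp
        then show ?thesis using C(1) beta_gt_1 by (intro ennreal_leI mult_left_mono powr_mono) simp_all
      qed
      finally show "outer_measure_of lborel X' \<le> ennreal (2 * C * \<beta> powr (- (s * real N)))" .
    qed
    also have "\<dots> = ennreal (2 * \<beta> powr (- (s * real N)) + 2 * C * \<beta> powr (- (s * real N)))"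
      by (rule ennreal_plus[symmetric]) (use C(1) in simp_all)
    also have "2 * \<beta> powr (- (s * real N)) + 2 * C * \<beta> powr (- (s * real N))
        = (2 + 2 * C) * \<beta> powr (- (s * real N))" by (rule distrib_right[symmetric])
    finally show "outer_measure_of lborel {y \<in> {0..<1}. \<forall>k<N. digit (h y) k = t k}
      \<le> ennreal ((2 + 2 * C) * \<beta> powr (- (s * real N)))" .
  qed
qed

end


section \<open>Hausdorff measure and counting words\<close>

lemma mdiam_le:
  assumes "\<And>x y. x \<in> S \<Longrightarrow> y \<in> S \<Longrightarrow> d x y \<le> c" "0 \<le> c"
  shows "mdiam d S \<le> c"
  unfolding mdiam_def using assms by (auto intro!: cSUP_least)

lemma dist_le_mdiam:
  assumes "x \<in> S" "y \<in> S" "\<And>x y. x \<in> S \<Longrightarrow> y \<in> S \<Longrightarrow> d x y \<le> c"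
  shows "d x y \<le> mdiam d S"
proof -
  have "bdd_above ((\<lambda>(x, y). d x y) ` (S \<times> S))" using assms(3) by (intro bdd_aboveI[of _ c]) auto
  from cSUP_upper[OF _ this, of "(x, y)"] show ?thesis using assms(1,2) by (auto simp: mdiam_def)
qed

context Metric_space
begin

lemma dist_le_of_mball:
  assumes "y \<in> mball x r" "z \<in> mball x r"
  shows "d y z \<le> 2 * r"
proof -
  have "x \<in> M" "y \<in> M" "z \<in> M" "d x y < r" "d x z < r" using assms by simp_all
  then show ?thesis using triangle[of y x z] commute[of y x] by simp
qed

lemma mdiam_mball_le: "0 \<le> r \<Longrightarrow> mdiam d (mball x r) \<le> 2 * r"
  by (rule mdiam_le[OF dist_le_of_mball[of _ x r]]) simp_all

lemma mdiam_mball_nonneg: "0 \<le> mdiam d (mball x r)"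
proof (cases "mball x r = {}")
  case True
  then show ?thesis by (simp add: mdiam_def)
next
  case False
  then obtain y where "y \<in> mball x r" by blast
  from dist_le_mdiam[of y "mball x r" y d, OF this this dist_le_of_mball[of _ x r]]
  have "d y y \<le> mdiam d (mball x r)" by simp
  then show ?thesis using nonneg[of y y] by linarith
qed

lemma hausdorff_pre_le_measure:
  assumes "\<delta> > 0"
  shows "hausdorff_pre M d Z \<alpha> \<delta> \<le> hausdorff_measure M d Z \<alpha>"
proof (rule tendsto_lowerbound[OF tendsto_hausdorff_measure])
  show "\<forall>\<^sub>F x in at_right 0. hausdorff_pre M d Z \<alpha> \<delta> \<le> hausdorff_pre M d Z \<alpha> x"
    unfolding eventually_at_right_field
    using assms by (intro exI[of _ \<delta>]) (auto intro: hausdorff_pre_antimono)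
qed simp

text \<open>Used for the bound of the dimension by 1, where finitely many balls of one radius
  suffice. \<open>C\<close> does not depend on \<open>\<delta>\<close>, and
  \<open>\<alpha> > 0\<close> avoids the special case in \<open>diam_power\<close>.\<close>

lemma hausdorff_measure_finiteI:
  assumes "\<alpha> > 0" and "\<And>\<delta>. \<delta> > 0 \<Longrightarrow> \<exists>X r. finite X \<and> X \<subseteq> M \<and> 0 < r \<and> r \<le> \<delta> \<and> Z \<subseteq> (\<Union>x\<in>X. mball x r) \<and>
    real (card X) * (2 * r) powr \<alpha> \<le> C"
  shows "hausdorff_measure M d Z \<alpha> \<noteq> \<infinity>"
proof -
  have "hausdorff_pre M d Z \<alpha> \<delta> \<le> ennreal C" if \<delta>: "\<delta> > 0" for \<delta>
  proof -
    obtain X r where X: "finite X" "X \<subseteq> M" "0 < r" "r \<le> \<delta>" "Z \<subseteq> (\<Union>x\<in>X. mball x r)"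
      "real (card X) * (2 * r) powr \<alpha> \<le> C" using assms(2)[OF \<delta>] by (elim exE conjE) (rule that)
    obtain f where f: "bij_betw f {0..<card X} X" using ex_bij_betw_nat_finite[OF X(1)] by blast
    have img: "f ` {0..<card X} = X" using f by (simp add: bij_betw_def)
    have balls: "\<forall>i\<in>{0..<card X}. f i \<in> M \<and> 0 < r \<and> r \<le> \<delta>"
      using X(2,3,4) f bij_betwE by blast
    have cover: "Z \<subseteq> (\<Union>i\<in>{0..<card X}. mball (f i) r)"
    proof
      fix z assume "z \<in> Z"
      then obtain x where x: "x \<in> X" "z \<in> mball x r" using X(5) by blast
      then obtain i where "i \<in> {0..<card X}" "x = f i" using img by blast
      then show "z \<in> (\<Union>i\<in>{0..<card X}. mball (f i) r)" using x(2) by blast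
    qed
    have "hausdorff_pre M d Z \<alpha> \<delta> \<le> (\<Sum>\<^sub>\<infinity>i\<in>{0..<card X}. diam_power d \<alpha> (mball (f i) r))"
      unfolding hausdorff_pre_def
      by (rule Inf_lower, rule CollectI,
          rule exI[of _ "{0..<card X}"], rule exI[of _ f], rule exI[of _ "\<lambda>_. r"])
        (use balls cover in blast)
    also have "\<dots> = (\<Sum>i\<in>{0..<card X}. diam_power d \<alpha> (mball (f i) r))" by simp
    also have "\<dots> \<le> (\<Sum>i\<in>{0..<card X}. ennreal ((2 * r) powr \<alpha>))"
    proof (rule sum_mono)
      fix i
      show "diam_power d \<alpha> (mball (f i) r) \<le> ennreal ((2 * r) powr \<alpha>)"
        using assms(1) mdiam_mball_le[of r "f i"] mdiam_mball_nonneg[of "f i" r] X(3)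
        by (auto simp: diam_power_def intro!: ennreal_leI powr_mono2)
    qed
    also have "\<dots> = ennreal (real (card X) * (2 * r) powr \<alpha>)"
      by (subst sum_ennreal) auto
    also have "\<dots> \<le> ennreal C" using X(6) by (rule ennreal_leI)
    finally show ?thesis .
  qed
  then have "\<forall>\<^sub>F \<delta> in at_right 0. hausdorff_pre M d Z \<alpha> \<delta> \<le> ennreal C"
    unfolding eventually_at_right_field by (intro exI[of _ 1]) simp
  then have "hausdorff_measure M d Z \<alpha> \<le> ennreal C"
    by (rule tendsto_upperbound[OF tendsto_hausdorff_measure]) simp
  then show ?thesis by (metis ennreal_neq_top infinity_ennreal_def top_unique)
qed

text \<open>
  A Frostman-type bound: the mass distribution is the image of Lebesgue measure under \<open>h\<close>.
\<close>

lemma hausdorff_measure_infiniteI: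
  assumes "0 < \<alpha>" "\<alpha> < s" and K: "0 < K" and h: "\<And>y. y \<in> {0..<1} \<Longrightarrow> h y \<in> Z"
    and mass: "\<And>x r. x \<in> M \<Longrightarrow> 0 < r \<Longrightarrow>
      outer_measure_of lborel {y \<in> {0..<1::real}. h y \<in> mball x r} \<le> ennreal (K * mdiam d (mball x r) powr s)"
  shows "hausdorff_measure M d Z \<alpha> = \<infinity>"
proof -
  \<comment> \<open>A ball of radius at most \<open>\<delta>\<close> has diameter D at most
    \<open>2 * \<delta>\<close>, so \<open>D powr s \<le> (2 * \<delta>) powr (s - \<alpha>) * D
    powr \<alpha>\<close>. The preimages under \<open>h\<close> of a cover of \<open>Z\<close> cover
    [0,1), which has measure 1, so the sum over the cover cannot be small; the bound blows up as
    \<open>\<delta>\<close> tends to 0.\<close>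
  have pre: "ennreal (1 / (K * (2 * \<delta>) powr (s - \<alpha>))) \<le> hausdorff_pre M d Z \<alpha> \<delta>" if \<delta>: "\<delta> > 0" for \<delta>
    unfolding hausdorff_pre_def
  proof (rule Inf_greatest)
    fix S
    assume "S \<in> {(\<Sum>\<^sub>\<infinity>i\<in>I. diam_power d \<alpha> (mball (x i) (r i))) | (I :: nat set) x r.
      (\<forall>i\<in>I. x i \<in> M \<and> 0 < r i \<and> r i \<le> \<delta>) \<and> Z \<subseteq> (\<Union>i\<in>I. mball (x i) (r i))}"
    then obtain I :: "nat set" and x r where S: "S = (\<Sum>\<^sub>\<infinity>i\<in>I. diam_power d \<alpha> (mball (x i) (r i)))"
      and xr: "\<And>i. i \<in> I \<Longrightarrow> x i \<in> M \<and> 0 < r i \<and> r i \<le> \<delta>" and cover: "Z \<subseteq> (\<Union>i\<in>I. mball (x i) (r i))"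
      by blast
    define \<kappa> where "\<kappa> = K * (2 * \<delta>) powr (s - \<alpha>)"
    have \<kappa>: "\<kappa> > 0" using K \<delta> by (simp add: \<kappa>_def)
    let ?E = "\<lambda>i. {y \<in> {0..<1}. h y \<in> mball (x i) (r i)}"
    have le: "outer_measure_of lborel (?E i) \<le> ennreal \<kappa> * diam_power d \<alpha> (mball (x i) (r i))" if i: "i \<in> I" for i
    proof -
      let ?D = "mdiam d (mball (x i) (r i))"
      have D: "?D \<le> 2 * \<delta>" using mdiam_mball_le[of "r i" "x i"] xr[OF i] by simp
      have D0: "0 \<le> ?D" by (rule mdiam_mball_nonneg)
      have "outer_measure_of lborel (?E i) \<le> ennreal (K * ?D powr s)" using mass xr[OF i] by blast
      also have "\<dots> \<le> ennreal (\<kappa> * ?D powr \<alpha>)"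
      proof (rule ennreal_leI)
        have "?D powr s = ?D powr (s - \<alpha>) * ?D powr \<alpha>" by (simp add: powr_add[symmetric])
        also have "\<dots> \<le> (2 * \<delta>) powr (s - \<alpha>) * ?D powr \<alpha>"
          using D D0 assms(2) by (intro mult_right_mono powr_mono2) auto
        finally show "K * ?D powr s \<le> \<kappa> * ?D powr \<alpha>"
          unfolding \<kappa>_def using K by (simp add: mult.assoc mult_left_mono)
      qed
      finally show ?thesis using assms(1) \<kappa> by (simp add: diam_power_def ennreal_mult)
    qed
    have "{0..<1} \<subseteq> (\<Union>i\<in>I. ?E i)"
    proof
      fix y :: real assume y: "y \<in> {0..<1}"
      then have "h y \<in> (\<Union>i\<in>I. mball (x i) (r i))" using h cover by blast
      then show "y \<in> (\<Union>i\<in>I. ?E i)" using y by simp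
    qed
    then have "outer_measure_of lborel {0..<1::real} \<le> outer_measure_of lborel (\<Union>i\<in>I. ?E i)"
      by (rule outer_measure_of_mono)
    then have "1 \<le> outer_measure_of lborel (\<Union>i\<in>I. ?E i)" by simp
    also have "\<dots> \<le> (\<Sum>\<^sub>\<infinity>i\<in>I. outer_measure_of lborel (?E i))"
      by (rule outer_measure_of_UN_le_infsum) simp
    also have "\<dots> \<le> (\<Sum>\<^sub>\<infinity>i\<in>I. ennreal \<kappa> * diam_power d \<alpha> (mball (x i) (r i)))"
      using le by (intro infsum_mono nonneg_summable_on_complete) auto
    also have "\<dots> = ennreal \<kappa> * S"
      unfolding S by (rule infsum_cmult_right_ennreal) simp
    finally have "ennreal (1 / \<kappa>) * 1 \<le> ennreal (1 / \<kappa>) * (ennreal \<kappa> * S)" by (rule mult_left_mono) simp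
    also have "\<dots> = S"
      using \<kappa> by (simp add: mult.assoc[symmetric] ennreal_mult[symmetric])
    finally show "ennreal (1 / (K * (2 * \<delta>) powr (s - \<alpha>))) \<le> S" by (simp add: \<kappa>_def)
  qed
  have "ennreal X \<le> hausdorff_measure M d Z \<alpha>" if "X > 0" for X
  proof -
    \<comment> \<open>Solves \<open>K * (2 * \<delta>) powr (s - \<alpha>) = 1 / X\<close>.\<close>
    define \<delta> where "\<delta> = (1 / (K * X)) powr (1 / (s - \<alpha>)) / 2"
    have \<delta>: "\<delta> > 0" using K that by (simp add: \<delta>_def)
    have "(2 * \<delta>) powr (s - \<alpha>) = 1 / (K * X)"
      using assms(2) K that by (simp add: \<delta>_def powr_powr)
    then have "1 / (K * (2 * \<delta>) powr (s - \<alpha>)) = X" using K that by simp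
    then show ?thesis using pre[OF \<delta>] hausdorff_pre_le_measure[OF \<delta>, of Z \<alpha>] by (metis order_trans)
  qed
  note * = this
  show ?thesis
  proof (rule ccontr)
    assume "hausdorff_measure M d Z \<alpha> \<noteq> \<infinity>"
    then obtain m where m: "hausdorff_measure M d Z \<alpha> = ennreal m" "0 \<le> m"
      by (cases "hausdorff_measure M d Z \<alpha>") auto
    have "ennreal (m + 1) \<le> ennreal m" using *[of "m + 1"] m by simp
    then show False using m(2) by simp
  qed
qed

end

text \<open>The measure at the exponent 1 itself is left open, as it cannot affect the
  supremum.\<close>

lemma hausdorff_dim_eq_1:
  assumes "\<And>\<alpha>. 0 < \<alpha> \<Longrightarrow> \<alpha> < 1 \<Longrightarrow> hausdorff_measure M d Z \<alpha> = \<infinity>"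
    and "\<And>\<alpha>. 1 < \<alpha> \<Longrightarrow> hausdorff_measure M d Z \<alpha> \<noteq> \<infinity>"
  shows "hausdorff_dim M d Z = 1"
proof (rule antisym)
  show "hausdorff_dim M d Z \<le> 1"
    unfolding hausdorff_dim_def
  proof (rule Sup_least)
    fix a assume "a \<in> {ennreal \<alpha> | \<alpha>. 0 \<le> \<alpha> \<and> hausdorff_measure M d Z \<alpha> = \<infinity>}"
    then obtain \<alpha> where \<alpha>: "a = ennreal \<alpha>" "0 \<le> \<alpha>" "hausdorff_measure M d Z \<alpha> = \<infinity>" by blast
    then have "\<alpha> \<le> 1" using assms(2) by force
    then show "a \<le> 1" using \<alpha>(1) by simp
  qed
  show "1 \<le> hausdorff_dim M d Z"
  proof (rule dense_le)
    fix a :: ennreal assume a: "a < 1"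
    then obtain \<alpha> where \<alpha>: "a = ennreal \<alpha>" "0 \<le> \<alpha>" "\<alpha> < 1"
      by (cases a) (auto simp: ennreal_less_iff)
    \<comment> \<open>The midpoint to 1, since \<open>\<alpha>\<close> may be 0 and the first
      assumption asks for a positive exponent.\<close>
    let ?\<beta> = "(\<alpha> + 1) / 2"
    have "ennreal \<alpha> \<le> ennreal ?\<beta>" using \<alpha> by (intro ennreal_leI) simp
    also have "\<dots> \<le> hausdorff_dim M d Z"
      unfolding hausdorff_dim_def using assms(1)[of ?\<beta>] \<alpha> by (intro Sup_upper CollectI exI[of _ ?\<beta>]) simp
    finally show "a \<le> hausdorff_dim M d Z" using \<alpha>(1) by simp
  qed
qed

section \<open>Words of the points of a short interval\<close>

context beta_transformation
begin

definition full_at :: "nat \<Rightarrow> real \<Rightarrow> bool" where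
  "full_at n x \<longleftrightarrow> (\<exists>v. full n v \<and> (\<forall>k<n. digit v k = digit x k))"

lemma full_at_0: "full_at 0 x"
  unfolding full_at_def using full_0 by blast

text \<open>At the first place from \<open>i\<close> on where the digits differ, the point with the
  smaller digit acquires a full prefix by \<open>full_lower_digit\<close>.\<close>

lemma same_digits_of_not_full_at:
  assumes "x \<in> {0..<1}" "y \<in> {0..<1}" "i \<le> n" "\<forall>k<i. digit x k = digit y k"
    and "\<And>j. i < j \<Longrightarrow> j \<le> n \<Longrightarrow> \<not> full_at j x \<and> \<not> full_at j y"
  shows "\<forall>k<n. digit x k = digit y k"
  using assms(3,5)
proof (induction n rule: dec_induct)
  case base
  show ?case by (rule assms(4))
next
  case (step n)
  then have same: "\<forall>k<n. digit x k = digit y k" by simp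
  have *: "full_at (Suc n) u" if "w \<in> {0..<1}" "\<forall>k<n. digit u k = digit w k" "digit u n < digit w n" for u w
    using full_lower_digit[OF that(1,3)] that(2) unfolding full_at_def by (metis less_SucE)
  have "\<not> full_at (Suc n) x" "\<not> full_at (Suc n) y" using step by auto
  then have "digit x n = digit y n"
    using *[OF assms(2), of x] *[OF assms(1), of y] same by (metis linorder_neqE_nat)
  then show ?case using same by (auto simp: less_Suc_eq)
qed

text \<open>Left endpoints of distinct full cylinders are at least \<open>\<beta>^-i\<close> apart,
  so the integers \<open>?f v\<close> are distinct; they lie in a range governed by \<open>p\<close>
  and \<open>D\<close>.\<close>

lemma card_full_meeting:
  fixes i :: nat
  assumes B: "B \<subseteq> {0..<1}" "\<And>x. x \<in> B \<Longrightarrow> \<bar>x - p\<bar> \<le> D" and D: "0 \<le> D"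
  defines "V \<equiv> {v. full i v \<and> (\<exists>x\<in>B. \<forall>k<i. digit v k = digit x k)}"
  shows "finite V" "real (card V) \<le> 2 * D * \<beta> ^ i + 3"
proof -
  let ?f = "\<lambda>v. \<lfloor>v * \<beta> ^ i\<rfloor>"
  \<comment> \<open>The left endpoint may lie up to \<open>\<beta>^-i\<close> to the left of the
    point of \<open>B\<close>, hence the -1 at the lower end.\<close>
  let ?R = "{\<lfloor>(p - D) * \<beta> ^ i\<rfloor> - 1 .. \<lfloor>(p + D) * \<beta> ^ i\<rfloor>}"
  \<comment> \<open>With equal floors, \<open>v'\<close> lies in the cylinder of \<open>v\<close> at
    relative position \<open>t\<close>, so \<open>(T ^^ i) v' = t\<close>; but this iterate is 0 at
    a left endpoint.\<close>
  have eqI: "v = v'" if v: "v \<in> V" and v': "v' \<in> V" and le: "v \<le> v'" and eq: "?f v = ?f v'" for v v'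
  proof -
    have fv: "full i v" and fv': "full i v'" using v v' by (auto simp: V_def)
    define t where "t = (v' - v) * \<beta> ^ i"
    have "v' * \<beta> ^ i - v * \<beta> ^ i < 1" using eq by linarith
    then have t: "t \<in> {0..<1}" using le beta_pow_pos[of i] by (auto simp: t_def left_diff_distrib)
    have "v' = v + t / \<beta> ^ i" using beta_pos by (simp add: t_def)
    then have "(T ^^ i) v' = t" using fullD(2)[OF fv t] by simp
    then have "t = 0" using full_left_endpoint(2)[OF fv'] by simp
    then show ?thesis using \<open>v' = v + t / \<beta> ^ i\<close> by simp
  qed
  have inj: "inj_on ?f V"
  proof (rule inj_onI)
    fix v v' assume "v \<in> V" "v' \<in> V" "?f v = ?f v'"
    then show "v = v'" using eqI[of v v'] eqI[of v' v] by (cases "v \<le> v'") auto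
  qed
  have sub: "?f ` V \<subseteq> ?R"
  proof
    fix a assume "a \<in> ?f ` V"
    then obtain v x where v: "a = ?f v" "full i v" "x \<in> B" "\<forall>k<i. digit v k = digit x k"
      by (auto simp: V_def)
    have x: "x \<in> {0..<1}" using v(3) B(1) by blast
    have "v - x = - (T ^^ i) x / \<beta> ^ i"
      using diff_eq_of_same_digits[OF full_left_endpoint(1)[OF v(2)] x v(4)]
        full_left_endpoint(2)[OF v(2)] by simp
    then have eq: "v * \<beta> ^ i = x * \<beta> ^ i - (T ^^ i) x" using beta_pos by (simp add: field_simps)
    have "(p - D) * \<beta> ^ i \<le> x * \<beta> ^ i" "x * \<beta> ^ i \<le> (p + D) * \<beta> ^ i"
      using B(2)[OF v(3)] beta_pow_pos[of i] by (auto simp: abs_le_iff intro!: mult_right_mono)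
    then have "(p - D) * \<beta> ^ i - 1 \<le> v * \<beta> ^ i" "v * \<beta> ^ i \<le> (p + D) * \<beta> ^ i"
      using eq iterate_in[OF x, of i] by auto
    then show "a \<in> ?R" unfolding v(1) by (auto intro!: floor_mono) linarith
  qed
  show "finite V" by (rule inj_on_finite[OF inj sub]) simp
  have "card V \<le> card ?R" by (rule card_inj_on_le[OF inj sub]) simp
  moreover have "real (card ?R) \<le> 2 * D * \<beta> ^ i + 3"
  proof -
    have mono: "(p - D) * \<beta> ^ i \<le> (p + D) * \<beta> ^ i"
      using D beta_pow_pos[of i] by (intro mult_right_mono) auto
    have "real (card ?R) = real_of_int (\<lfloor>(p + D) * \<beta> ^ i\<rfloor> - \<lfloor>(p - D) * \<beta> ^ i\<rfloor> + 2)"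
      using floor_mono[OF mono] by simp
    also have "\<dots> \<le> (p + D) * \<beta> ^ i - (p - D) * \<beta> ^ i + 3" by linarith
    also have "\<dots> = 2 * D * \<beta> ^ i + 3" by (simp add: algebra_simps)
    finally show ?thesis .
  qed
  ultimately show "real (card V) \<le> 2 * D * \<beta> ^ i + 3" by linarith
qed

text \<open>
  A word is determined by its longest full prefix, since from there on it follows the maximal
  admissible continuation; full cylinders of order \<open>i\<close> are disjoint of length \<open>\<beta>\<^sup>-\<^sup>i\<close>.
\<close>

lemma prefix_cover_of_bounded:
  assumes B: "B \<subseteq> {0..<1}" "\<And>x. x \<in> B \<Longrightarrow> \<bar>x - p\<bar> \<le> D" and D: "0 \<le> D"
  shows "\<exists>c. prefix_cover B n c \<and> real c \<le> (\<Sum>i\<le>n. 2 * D * \<beta> ^ i + 3)"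
proof -
  define V where "V i = {v. full i v \<and> (\<exists>x\<in>B. \<forall>k<i. digit v k = digit x k)}" for i
  note V = card_full_meeting[OF B D, folded V_def]
  define m where "m x = Max {i. i \<le> n \<and> full_at i x}" for x
  have fin: "finite {i. i \<le> n \<and> full_at i x}" for x by simp
  have m: "m x \<le> n" "full_at (m x) x" for x
    using Max_in[OF fin, of x] full_at_0[of x] unfolding m_def by blast+
  have m_max: "\<not> full_at j x" if "m x < j" "j \<le> n" for x j
  proof
    assume "full_at j x"
    then have "j \<le> m x" unfolding m_def using that(2) by (intro Max_ge) auto
    then show False using that(1) by simp
  qed
  \<comment> \<open>The word attached to a longest full prefix is read off from any point of
    \<open>B\<close> that has it; all such points agree on \<open>n\<close> digits.\<close>
  define F where "F = (\<lambda>(i, v). digit (SOME x. x \<in> B \<and> m x = i \<and> (\<forall>k<i. digit v k = digit x k)))"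
  define I where "I = (SIGMA i:{..n}. V i)"
  have "finite I" unfolding I_def using V(1) by auto
  have "prefix_cover B n (\<Sum>i\<le>n. card (V i))"
    unfolding prefix_cover_def
  proof (intro exI conjI ballI)
    show "finite (F ` I)" using \<open>finite I\<close> by simp
    have "card (F ` I) \<le> card I" using \<open>finite I\<close> by (rule card_image_le)
    also have "\<dots> = (\<Sum>i\<le>n. card (V i))" unfolding I_def using V(1) by (intro card_SigmaI) auto
    finally show "card (F ` I) \<le> (\<Sum>i\<le>n. card (V i))" .
    fix y assume y: "y \<in> B"
    obtain v where v: "full (m y) v" "\<forall>k<m y. digit v k = digit y k"
      using m(2)[of y] unfolding full_at_def by blast
    define x where "x = (SOME x. x \<in> B \<and> m x = m y \<and> (\<forall>k<m y. digit v k = digit x k))"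
    have x: "x \<in> B \<and> m x = m y \<and> (\<forall>k<m y. digit v k = digit x k)"
      unfolding x_def by (rule someI[of _ y]) (use y v in simp)
    have "\<forall>k<n. digit y k = digit x k"
    proof (rule same_digits_of_not_full_at)
      show "y \<in> {0..<1}" "x \<in> {0..<1}" using x y B(1) by blast+
      show "m y \<le> n" by (rule m(1))
      show "\<forall>k<m y. digit y k = digit x k" using x v by simp
      show "\<not> full_at j y \<and> \<not> full_at j x" if "m y < j" "j \<le> n" for j
        using that m_max[of y j] m_max[of x j] x by simp
    qed
    moreover have "(m y, v) \<in> I" unfolding I_def V_def using m(1)[of y] v y by auto
    moreover have "F (m y, v) = digit x" by (simp add: F_def x_def)
    ultimately show "\<exists>s\<in>F ` I. \<forall>i<n. digit y i = s i" by (metis imageI)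
  qed
  moreover have "real (\<Sum>i\<le>n. card (V i)) \<le> (\<Sum>i\<le>n. 2 * D * \<beta> ^ i + 3)"
    unfolding of_nat_sum by (intro sum_mono V(2))
  ultimately show ?thesis by blast
qed

text \<open>At this scale each order up to \<open>n\<close> contributes at most 2 + 3 full
  cylinders, so the number of words is linear in \<open>n\<close> however short their cylinders
  are.\<close>

lemma prefix_cover_small:
  assumes "B \<subseteq> {0..<1}" "\<And>x. x \<in> B \<Longrightarrow> \<bar>x - p\<bar> \<le> 1 / \<beta> ^ n"
  shows "\<exists>c. prefix_cover B n c \<and> real c \<le> 5 * (1 + real n)"
proof -
  obtain c where c: "prefix_cover B n c" "real c \<le> (\<Sum>i\<le>n. 2 * (1 / \<beta> ^ n) * \<beta> ^ i + 3)"
    using prefix_cover_of_bounded[OF assms, of n] beta_pow_pos[of n] by auto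
  have "(\<Sum>i\<le>n. 2 * (1 / \<beta> ^ n) * \<beta> ^ i + 3) \<le> (\<Sum>i\<le>n. 5)"
  proof (rule sum_mono)
    fix i assume "i \<in> {..n}"
    then have "\<beta> ^ i \<le> \<beta> ^ n" using beta_gt_1 by (intro power_increasing) auto
    then have "\<beta> ^ i / \<beta> ^ n \<le> 1" using beta_pow_pos[of n] by simp
    then show "2 * (1 / \<beta> ^ n) * \<beta> ^ i + 3 \<le> 5" by simp
  qed
  then show ?thesis using c by auto
qed

text \<open>A form of Renyi's bound on the number of admissible words, with a cruder constant: the 3
  is absorbed into \<open>3 * \<beta> ^ i\<close> before summing the geometric series.\<close>

lemma prefix_cover_unit_interval:
  "\<exists>c. prefix_cover {0..<1} n c \<and> real c \<le> 5 * \<beta> / (\<beta> - 1) * \<beta> ^ n"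
proof -
  obtain c where c: "prefix_cover {0..<1} n c" "real c \<le> (\<Sum>i\<le>n. 2 * 1 * \<beta> ^ i + 3)"
    using prefix_cover_of_bounded[of "{0..<1}" 0 1 n] by auto
  have "(\<Sum>i\<le>n. 2 * 1 * \<beta> ^ i + 3) \<le> (\<Sum>i\<le>n. 5 * \<beta> ^ i)"
  proof (rule sum_mono)
    fix i
    have "1 \<le> \<beta> ^ i" using beta_gt_1 by (intro one_le_power) simp
    then show "2 * 1 * \<beta> ^ i + 3 \<le> 5 * \<beta> ^ i" by simp
  qed
  also have "\<dots> = 5 * ((\<beta> ^ Suc n - 1) / (\<beta> - 1))"
    using beta_gt_1 geometric_sum[of \<beta> "Suc n"] by (simp add: sum_distrib_left[symmetric] lessThan_Suc_atMost)
  also have "\<dots> \<le> 5 * (\<beta> ^ Suc n / (\<beta> - 1))"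
    using beta_gt_1 by (intro mult_left_mono divide_right_mono) auto
  finally show ?thesis using c by auto
qed

text \<open>The junk value \<open>0 powr s = 0\<close> is harmless: for \<open>D = 0\<close> the hypothesis holds for all \<open>N\<close>.\<close>

lemma mass_bound_of_scales:
  assumes "0 \<le> D" "D \<le> 1" "0 \<le> K" "0 < s"
    and "\<And>N :: nat. D \<le> 1 / \<beta> ^ N \<Longrightarrow> \<mu> \<le> ennreal (K * \<beta> powr (- (s * real N)))"
  shows "\<mu> \<le> ennreal (K * \<beta> powr s * D powr s)"
proof (cases "D = 0")
  case True
  have "(\<lambda>N. K * (\<beta> powr (- s)) ^ N) \<longlonglongrightarrow> K * 0"
    using beta_gt_1 assms(4) by (intro tendsto_mult tendsto_const LIMSEQ_power_zero) (auto simp: powr_less_one)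
  then have "(\<lambda>N. ennreal (K * (\<beta> powr (- s)) ^ N)) \<longlonglongrightarrow> ennreal (K * 0)"
    by (rule tendsto_ennrealI)
  moreover have "\<mu> \<le> ennreal (K * (\<beta> powr (- s)) ^ N)" for N
    using assms(5)[of N] True beta_pos
    by (simp add: powr_realpow[symmetric] powr_powr less_imp_le)
  ultimately have "\<mu> \<le> ennreal (K * 0)"
    by (intro LIMSEQ_le_const) auto
  then show ?thesis by simp
next
  case False
  then have D: "D > 0" using assms(1) by simp
  \<comment> \<open>The largest scale index with \<open>D \<le> \<beta>^-N\<close>. Then D exceeds
    \<open>\<beta>^-(N+1)\<close>, and rounding costs the factor
    \<open>\<beta> powr s\<close>.\<close>
  define N where "N = nat \<lfloor>log \<beta> (1 / D)\<rfloor>"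
  have log0: "0 \<le> log \<beta> (1 / D)" using D assms(2) beta_gt_1 by simp
  have "real N \<le> log \<beta> (1 / D)" "log \<beta> (1 / D) < real N + 1"
    unfolding N_def using log0 by linarith+
  then have le: "\<beta> powr real N \<le> 1 / D" and lt: "1 / D < \<beta> powr (real N + 1)"
    using D beta_gt_1 by (simp_all add: le_log_iff log_less_iff)
  have "D \<le> 1 / \<beta> ^ N"
    using le D beta_pow_pos[of N] beta_pos by (simp add: powr_realpow field_simps)
  then have "\<mu> \<le> ennreal (K * \<beta> powr (- (s * real N)))" by (rule assms(5))
  also have "\<dots> \<le> ennreal (K * \<beta> powr s * D powr s)"
  proof (rule ennreal_leI)
    have "\<beta> powr (- (real N + 1)) \<le> D"
    proof -
      have "1 / \<beta> powr (real N + 1) < D" using lt D beta_pos by (simp add: divide_less_eq mult.commute)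
      then show ?thesis by (simp only: powr_minus_divide less_imp_le)
    qed
    then have "(\<beta> powr (- (real N + 1))) powr s \<le> D powr s"
      using assms(4) by (intro powr_mono2) auto
    then have "\<beta> powr s * \<beta> powr (- (real N + 1) * s) \<le> \<beta> powr s * D powr s"
      by (intro mult_left_mono) (simp_all add: powr_powr)
    also have "\<beta> powr s * \<beta> powr (- (real N + 1) * s) = \<beta> powr (- (s * real N))"
      by (simp add: powr_add[symmetric] algebra_simps)
    finally show "K * \<beta> powr (- (s * real N)) \<le> K * \<beta> powr s * D powr s"
      using assms(3) by (simp add: mult.assoc mult_left_mono)
  qed
  finally show ?thesis .
qed

end


section \<open>The irregular sets\<close>

lemma funpow_shift: "(shift ^^ i) z = (\<lambda>k. z (i + k))"
  by (induction i) (auto simp: shift_def)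

text \<open>Take a cluster value \<open>u\<close>. As \<open>X\<close> does not tend to
  \<open>u\<close>, it is infinitely often at least \<open>e\<close> away from it, and infinitely
  often so on one fixed side; \<open>a\<close> and \<open>b\<close> separate these values from those
  near \<open>u\<close>.\<close>

lemma oscillation_of_not_convergent:
  fixes X :: "nat \<Rightarrow> real"
  assumes bdd: "\<And>n. \<bar>X n\<bar> \<le> M" and "\<not> convergent X"
  obtains a b where "a < b" "\<And>n0. \<exists>n\<ge>n0. X n < a" "\<And>n0. \<exists>n\<ge>n0. X n > b"
proof -
  have "bounded (range X)" using bdd by (auto simp: bounded_iff)
  then obtain u r where r: "strict_mono r" "(X \<circ> r) \<longlonglongrightarrow> u"
    using bounded_imp_convergent_subsequence by metis
  have sub: "\<exists>n\<ge>n0. \<bar>X n - u\<bar> < e" if e: "e > 0" for e n0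
  proof -
    obtain N where "\<forall>n\<ge>N. norm ((X \<circ> r) n - u) < e" using LIMSEQ_D[OF r(2) e] by blast
    then have "\<bar>X (r (max N n0)) - u\<bar> < e" by simp
    moreover have "n0 \<le> r (max N n0)"
      using strict_mono_imp_increasing[OF r(1), of "max N n0"] by simp
    ultimately show ?thesis by blast
  qed
  have "\<not> X \<longlonglongrightarrow> u" using assms(2) convergentI by blast
  then obtain e where e: "e > 0" "\<And>n0. \<exists>n\<ge>n0. e \<le> \<bar>X n - u\<bar>"
    unfolding LIMSEQ_iff by (force simp: not_less)
  show ?thesis
  proof (cases "\<forall>n0. \<exists>n\<ge>n0. u + e \<le> X n")
    case True
    show ?thesis
    proof (rule that[of "u + e / 3" "u + e / 2"])
      show "u + e / 3 < u + e / 2" using e(1) by simp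
      show "\<exists>n\<ge>n0. X n < u + e / 3" for n0
      proof -
        obtain n where "n \<ge> n0" "\<bar>X n - u\<bar> < e / 3" using sub[of "e / 3" n0] e(1) by auto
        then show ?thesis by (intro exI[of _ n] conjI) linarith+
      qed
      show "\<exists>n\<ge>n0. u + e / 2 < X n" for n0
      proof -
        obtain n where "n \<ge> n0" "u + e \<le> X n" using True by blast
        then show ?thesis using e(1) by (intro exI[of _ n]) simp
      qed
    qed
  next
    case False
    then obtain n1 where "\<forall>n\<ge>n1. \<not> u + e \<le> X n" by blast
    then have n1: "X n < u + e" if "n \<ge> n1" for n using that by (simp add: not_le)
    show ?thesis
    proof (rule that[of "u - e / 2" "u - e / 3"])
      show "u - e / 2 < u - e / 3" using e(1) by simp
      show "\<exists>n\<ge>n0. X n < u - e / 2" for n0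
      proof -
        obtain n where "n \<ge> max n0 n1" "e \<le> \<bar>X n - u\<bar>" using e(2) by blast
        then show ?thesis using n1[of n] e(1) by (intro exI[of _ n]) auto
      qed
      show "\<exists>n\<ge>n0. u - e / 3 < X n" for n0
      proof -
        obtain n where "n \<ge> n0" "\<bar>X n - u\<bar> < e / 3" using sub[of "e / 3" n0] e(1) by auto
        then show ?thesis by (intro exI[of _ n] conjI) linarith+
      qed
    qed
  qed
qed

section \<open>The dimension in the interval\<close>

context beta_transformation
begin

lemma small_power:
  assumes "\<epsilon> > 0"
  obtains m where "1 / \<beta> ^ m < \<epsilon>"
proof -
  obtain m where "(1 / \<beta>) ^ m < \<epsilon>" using real_arch_pow_inv[OF assms, of "1 / \<beta>"] beta_gt_1 by auto
  then show ?thesis using that by (simp add: power_divide)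
qed

lemma mem_irregular_set_interval:
  "x \<in> irregular_set {0..<1} T \<phi> \<longleftrightarrow> x \<in> {0..<1} \<and> \<not> convergent (\<lambda>n. bsum \<phi> n x / real n)"
  by (simp add: irregular_set_def bsum_def)

lemma Metric_space_unit_interval: "Metric_space {0..<1::real} dist"
  by unfold_locales (auto simp: dist_commute dist_triangle)

text \<open>Lower bound: the mass of a ball is at most the number of words of its points times the
  mass of one cylinder. Upper bound: equally spaced balls cover the whole interval.\<close>

lemma irregular_interval_dim:
  assumes cont: "continuous_on {0..1} \<phi>" and ne: "irregular_set {0..<1} T \<phi> \<noteq> {}"
  shows "hausdorff_dim {0..<1} dist (irregular_set {0..<1} T \<phi>) = 1"
proof -
  interpret I: Metric_space "{0..<1::real}" dist by (rule Metric_space_unit_interval)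
  have "bounded (\<phi> ` {0..1})" using cont by (intro compact_imp_bounded compact_continuous_image) auto
  then obtain M where M: "\<And>x. x \<in> {0..<1} \<Longrightarrow> \<bar>\<phi> x\<bar> \<le> M" by (force simp: bounded_iff)
  have dc: "digit_continuous \<phi>"
    unfolding digit_continuous_def
  proof (intro allI impI)
    fix \<eta> :: real assume "\<eta> > 0"
    have "uniformly_continuous_on {0..1} \<phi>" using cont by (intro compact_uniformly_continuous) auto
    then obtain e where e: "e > 0" "\<And>x y. x \<in> {0..1} \<Longrightarrow> y \<in> {0..1} \<Longrightarrow> dist x y < e \<Longrightarrow> dist (\<phi> x) (\<phi> y) < \<eta>"
      using \<open>\<eta> > 0\<close> unfolding uniformly_continuous_on_def by metis
    obtain m where m: "1 / \<beta> ^ m < e" using small_power[OF e(1)] by blast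
    have "\<bar>\<phi> x - \<phi> y\<bar> < \<eta>" if "x \<in> {0..<1}" "y \<in> {0..<1}" "\<forall>k<m. digit x k = digit y k" for x y
    proof -
      have "dist x y < e" using dist_le_of_same_digits[OF that] m by (simp add: dist_real_def)
      then show ?thesis using e(2)[of x y] that(1,2) by (simp add: dist_real_def)
    qed
    then show "\<exists>m. \<forall>x\<in>{0..<1}. \<forall>y\<in>{0..<1}. (\<forall>k<m. digit x k = digit y k) \<longrightarrow> \<bar>\<phi> x - \<phi> y\<bar> < \<eta>"
      by blast
  qed
  obtain x0 where x0: "x0 \<in> {0..<1}" "\<not> convergent (\<lambda>n. bsum \<phi> n x0 / real n)"
    using ne mem_irregular_set_interval by blast
  have M0: "0 \<le> M" using M[of 0] by simp
  have avg: "\<bar>bsum \<phi> n x0 / real n\<bar> \<le> M" for n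
    using bsum_bounded[where n = n, OF M x0(1)] M0 by (cases "n = 0") (auto simp: abs_divide field_simps)
  obtain a b where ab: "a < b" "\<And>n0. \<exists>n\<ge>n0. bsum \<phi> n x0 / real n < a"
      "\<And>n0. \<exists>n\<ge>n0. bsum \<phi> n x0 / real n > b"
    using oscillation_of_not_convergent[OF avg x0(2)] by blast
  have lo: "\<exists>n\<ge>n0. \<exists>x\<in>{0..<1}. bsum \<phi> n x < a * real n" for n0
  proof -
    obtain n where n: "n \<ge> max 1 n0" "bsum \<phi> n x0 / real n < a" using ab(2) by blast
    then have "bsum \<phi> n x0 < a * real n" by (simp add: pos_divide_less_eq)
    then show ?thesis using n(1) x0(1) by (intro exI[of _ n] conjI bexI[of _ x0]) simp_all
  qed
  have hi: "\<exists>n\<ge>n0. \<exists>x\<in>{0..<1}. bsum \<phi> n x > b * real n" for n0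
  proof -
    obtain n where n: "n \<ge> max 1 n0" "bsum \<phi> n x0 / real n > b" using ab(3) by blast
    then have "bsum \<phi> n x0 > b * real n" by (simp add: pos_less_divide_eq)
    then show ?thesis using n(1) x0(1) by (intro exI[of _ n] conjI bexI[of _ x0]) simp_all
  qed
  show ?thesis
  proof (rule hausdorff_dim_eq_1)
    fix \<alpha> :: real assume \<alpha>: "0 < \<alpha>" "\<alpha> < 1"
    define s where "s = (\<alpha> + 1) / 2"
    \<comment> \<open>The mass distribution is built for the larger exponent \<open>s'\<close>; the
      gap \<open>s' - s\<close> absorbs the linear word count of
      \<open>prefix_cover_small\<close>.\<close>
    define s' where "s' = (\<alpha> + 3) / 4"
    have s: "0 < s" "\<alpha> < s" "s < s'" "s' < 1" "0 < s'" using \<alpha> by (simp_all add: s_def s'_def field_simps)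
    have "\<exists>(h :: real \<Rightarrow> real) K. (\<forall>y\<in>{0..<1}. h y \<in> {0..<1} \<and> \<not> convergent (\<lambda>n. bsum \<phi> n (h y) / real n)) \<and>
      0 \<le> K \<and> (\<forall>N t. outer_measure_of lborel {y \<in> {0..<1}. \<forall>k<N. digit (h y) k = t k}
        \<le> ennreal (K * \<beta> powr (- (s' * real N))))"
      by (rule irregular_mass_distribution[OF M dc ab(1) lo hi s(5) s(4)])
    then obtain h :: "real \<Rightarrow> real" and K where h: "\<forall>y\<in>{0..<1}. h y \<in> {0..<1} \<and> \<not> convergent (\<lambda>n. bsum \<phi> n (h y) / real n)"
      and K: "K \<ge> 0" and mass: "\<forall>N t. outer_measure_of lborel {y \<in> {0..<1}. \<forall>k<N. digit (h y) k = t k}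
        \<le> ennreal (K * \<beta> powr (- (s' * real N)))" by (elim exE conjE)
    obtain C where C: "C \<ge> 0" "\<And>n. 1 + real n * 1 \<le> C * \<beta> powr (real n * (s' - s))"
      using linear_le_powr(2)[OF beta_gt_1, of "s' - s" 1] s(3) by auto
    show "hausdorff_measure {0..<1} dist (irregular_set {0..<1} T \<phi>) \<alpha> = \<infinity>"
    proof (rule I.hausdorff_measure_infiniteI[OF \<alpha>(1) s(2)])
      \<comment> \<open>The added 1 provides the strictly positive constant that the criterion
        demands.\<close>
      show "0 < 5 * C * K * \<beta> powr s + 1" using C(1) K by (intro add_nonneg_pos mult_nonneg_nonneg) auto
      show "h y \<in> irregular_set {0..<1} T \<phi>" if "y \<in> {0..<1}" for y
        using h that unfolding mem_irregular_set_interval by blast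
      fix x r :: real assume x: "x \<in> {0..<1}" and r: "0 < r"
      define B where "B = I.mball x r"
      have B: "B \<subseteq> {0..<1}" "x \<in> B" using x r by (auto simp: B_def)
      have D: "0 \<le> mdiam dist B" unfolding B_def by (rule I.mdiam_mball_nonneg)
      have D1: "mdiam dist B \<le> 1"
      proof (rule mdiam_le)
        fix u v assume "u \<in> B" "v \<in> B"
        then have "u \<in> {0..<1}" "v \<in> {0..<1}" using B(1) by blast+
        then show "dist u v \<le> 1" by (auto simp: dist_real_def abs_le_iff)
      qed simp
      have near: "\<bar>z - x\<bar> \<le> mdiam dist B" if "z \<in> B" for z
        using dist_le_mdiam[of z B x dist, OF that B(2) I.dist_le_of_mball[of _ x r]]
        by (simp add: B_def dist_real_def)
      have "outer_measure_of lborel {y \<in> {0..<1}. h y \<in> B} \<le> ennreal (5 * C * K * \<beta> powr s * mdiam dist B powr s)"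
      proof (rule mass_bound_of_scales[OF D D1 _ s(1)])
        show "0 \<le> 5 * C * K" using C K by simp
        fix N :: nat assume N: "mdiam dist B \<le> 1 / \<beta> ^ N"
        obtain c where c: "prefix_cover B N c" "real c \<le> 5 * (1 + real N)"
          using prefix_cover_small[OF B(1), of x N] near N by (meson order_trans)
        obtain S where S: "finite S" "card S \<le> c" "\<forall>y\<in>B. \<exists>t\<in>S. \<forall>i<N. digit y i = t i"
          using c(1) unfolding prefix_cover_def by blast
        let ?E = "\<lambda>t. {y \<in> {0..<1}. \<forall>k<N. digit (h y) k = t k}"
        have "{y \<in> {0..<1}. h y \<in> B} \<subseteq> (\<Union>t\<in>S. ?E t)"
        proof
          fix y assume y: "y \<in> {y \<in> {0..<1}. h y \<in> B}"
          then obtain t where "t \<in> S" "\<forall>i<N. digit (h y) i = t i" using S(3) by blast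
          then show "y \<in> (\<Union>t\<in>S. ?E t)" using y by (intro UN_I[of t]) simp_all
        qed
        then have "outer_measure_of lborel {y \<in> {0..<1}. h y \<in> B} \<le> outer_measure_of lborel (\<Union>t\<in>S. ?E t)"
          by (rule outer_measure_of_mono)
        also have "\<dots> \<le> (\<Sum>t\<in>S. outer_measure_of lborel (?E t))"
          by (rule outer_measure_of_UN_le_sum[OF S(1)]) simp
        also have "\<dots> \<le> (\<Sum>t\<in>S. ennreal (K * \<beta> powr (- (s' * real N))))"
          by (intro sum_mono mass[rule_format])
        also have "\<dots> = ennreal (real (card S) * (K * \<beta> powr (- (s' * real N))))"
          using K by (subst sum_ennreal) simp_all
        also have "\<dots> \<le> ennreal (5 * C * K * \<beta> powr (- (s * real N)))"
        proof (rule ennreal_leI)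
          have "real (card S) \<le> 5 * (1 + real N * 1)" using S(2) c(2) by simp
          also have "\<dots> \<le> 5 * (C * \<beta> powr (real N * (s' - s)))" using C(2) by (rule mult_left_mono) simp
          finally have "real (card S) * (K * \<beta> powr (- (s' * real N)))
              \<le> 5 * (C * \<beta> powr (real N * (s' - s))) * (K * \<beta> powr (- (s' * real N)))"
            using K by (intro mult_right_mono) simp_all
          also have "\<dots> = 5 * C * K * (\<beta> powr (real N * (s' - s)) * \<beta> powr (- (s' * real N)))"
            by (simp only: mult_ac)
          also have "\<beta> powr (real N * (s' - s)) * \<beta> powr (- (s' * real N)) = \<beta> powr (- (s * real N))"
            by (simp add: powr_add[symmetric] algebra_simps)
          finally show "real (card S) * (K * \<beta> powr (- (s' * real N))) \<le> 5 * C * K * \<beta> powr (- (s * real N))" .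
        qed
        finally show "outer_measure_of lborel {y \<in> {0..<1}. h y \<in> B} \<le> ennreal (5 * C * K * \<beta> powr (- (s * real N)))" .
      qed
      also have "\<dots> \<le> ennreal ((5 * C * K * \<beta> powr s + 1) * mdiam dist B powr s)"
        by (intro ennreal_leI mult_right_mono) simp_all
      finally show "outer_measure_of lborel {y \<in> {0..<1}. h y \<in> I.mball x r}
          \<le> ennreal ((5 * C * K * \<beta> powr s + 1) * mdiam dist (I.mball x r) powr s)"
        unfolding B_def .
    qed
  next
    fix \<alpha> :: real assume \<alpha>: "1 < \<alpha>"
    show "hausdorff_measure {0..<1} dist (irregular_set {0..<1} T \<phi>) \<alpha> \<noteq> \<infinity>"
    proof (rule I.hausdorff_measure_finiteI)
      show "0 < \<alpha>" using \<alpha> by simp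
      fix \<delta> :: real assume \<delta>: "\<delta> > 0"
      obtain n :: nat where n: "n > 0" "1 / real n < \<delta>"
        using ex_inverse_of_nat_less[OF \<delta>] by (auto simp: inverse_eq_divide)
      define X where "X = (\<lambda>i. real i / real n) ` {..<n}"
      have "irregular_set {0..<1} T \<phi> \<subseteq> (\<Union>x\<in>X. I.mball x (1 / real n))"
      proof
        fix z assume "z \<in> irregular_set {0..<1} T \<phi>"
        then have z: "0 \<le> z" "z < 1" by (auto simp: mem_irregular_set_interval)
        define i where "i = nat \<lfloor>real n * z\<rfloor>"
        have i: "real i \<le> real n * z" "real n * z < real i + 1"
          using z n(1) unfolding i_def by (auto simp: le_nat_floor)
        have "real i < real n" 
        proof -
          have "real n * z < real n" using z n(1) by simp
          then show ?thesis using i(1) by linarith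
        qed
        then have "i < n" by simp
        moreover have "z \<in> I.mball (real i / real n) (1 / real n)"
        proof -
          have "real i / real n \<le> z" using i(1) n(1) by (simp add: pos_divide_le_eq mult.commute)
          moreover have "z < (real i + 1) / real n" using i(2) n(1) by (simp add: pos_less_divide_eq mult.commute)
          then have "z < real i / real n + 1 / real n" by (simp only: add_divide_distrib)
          moreover have "0 \<le> real i / real n" by simp
          ultimately show ?thesis using z by (simp add: dist_real_def abs_less_iff)
        qed
        ultimately show "z \<in> (\<Union>x\<in>X. I.mball x (1 / real n))" unfolding X_def by blast
      qed
      moreover have "X \<subseteq> {0..<1}" unfolding X_def by (auto simp: field_simps)
      moreover have "real (card X) * (2 * (1 / real n)) powr \<alpha> \<le> 2 powr \<alpha>"
      proof -
        have "card X \<le> n" unfolding X_def using card_image_le[of "{..<n}"] by simp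
        then have "real (card X) * (2 * (1 / real n)) powr \<alpha> \<le> real n * (2 * (1 / real n)) powr \<alpha>"
          by (intro mult_right_mono) simp_all
        also have "\<dots> = 2 powr \<alpha> * (real n / real n powr \<alpha>)"
          using n(1) by (simp add: powr_divide)
        also have "\<dots> \<le> 2 powr \<alpha> * 1"
          using n(1) \<alpha> powr_mono[of 1 \<alpha> "real n"] by (intro mult_left_mono) simp_all
        finally show ?thesis by simp
      qed
      ultimately show "\<exists>X r. finite X \<and> X \<subseteq> {0..<1} \<and> 0 < r \<and> r \<le> \<delta> \<and>
          irregular_set {0..<1} T \<phi> \<subseteq> (\<Union>x\<in>X. I.mball x r) \<and> real (card X) * (2 * r) powr \<alpha> \<le> 2 powr \<alpha>"
        using n by (intro exI[of _ X] exI[of _ "1 / real n"]) (simp add: X_def)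
    qed
  qed
qed


section \<open>Cylinders, compactness and metric of the shift space\<close>

lemma topspace_full_shift: "z \<in> topspace (full_shift_topology \<beta>) \<longleftrightarrow> (\<forall>k. z k \<le> max_digit \<beta>)"
  by (auto simp: full_shift_topology_def PiE_iff)

lemma openin_full_shift_cylinder:
  assumes "\<And>k. z k \<le> max_digit \<beta>"
  shows "openin (full_shift_topology \<beta>) {t. (\<forall>k. t k \<le> max_digit \<beta>) \<and> (\<forall>k<n. t k = z k)}"
proof -
  define U where "U k = (if k < n then {z k} else {0..max_digit \<beta>})" for k
  have "openin (full_shift_topology \<beta>) (Pi\<^sub>E UNIV U)"
    unfolding full_shift_topology_def openin_PiE_gen
  proof (intro disjI2 conjI ballI)
    have "{i \<in> UNIV. U i \<noteq> topspace (discrete_topology {0..max_digit \<beta>})} \<subseteq> {..<n}"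
      by (auto simp: U_def)
    then show "finite {i \<in> UNIV. U i \<noteq> topspace (discrete_topology {0..max_digit \<beta>})}"
      by (rule finite_subset) simp
  qed (use assms in \<open>auto simp: U_def\<close>)
  moreover have "Pi\<^sub>E UNIV U = {t. (\<forall>k. t k \<le> max_digit \<beta>) \<and> (\<forall>k<n. t k = z k)}"
  proof (intro set_eqI)
    fix t
    have "t \<in> Pi\<^sub>E UNIV U \<longleftrightarrow> (\<forall>k. t k \<in> U k)" by (simp add: PiE_iff)
    also have "\<dots> \<longleftrightarrow> (\<forall>k. t k \<le> max_digit \<beta>) \<and> (\<forall>k<n. t k = z k)"
      using assms by (auto simp: U_def split: if_splits)
    finally show "t \<in> Pi\<^sub>E UNIV U \<longleftrightarrow> t \<in> {t. (\<forall>k. t k \<le> max_digit \<beta>) \<and> (\<forall>k<n. t k = z k)}" by simp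
  qed
  ultimately show ?thesis by simp
qed

lemma cylinder_in_open:
  assumes "openin (full_shift_topology \<beta>) U" "z \<in> U"
  shows "\<exists>n. \<forall>t. (\<forall>k. t k \<le> max_digit \<beta>) \<longrightarrow> (\<forall>k<n. t k = z k) \<longrightarrow> t \<in> U"
proof -
  obtain V where V: "finite {i. V i \<noteq> {0..max_digit \<beta>}}" "z \<in> Pi\<^sub>E UNIV V" "Pi\<^sub>E UNIV V \<subseteq> U"
    using assms unfolding full_shift_topology_def openin_product_topology_alt by auto
  obtain n where n: "\<And>i. V i \<noteq> {0..max_digit \<beta>} \<Longrightarrow> i < n"
    using V(1) unfolding finite_nat_set_iff_bounded by blast
  show ?thesis
  proof (intro exI[of _ n] allI impI)
    fix t :: "nat \<Rightarrow> nat" assume t: "\<forall>k. t k \<le> max_digit \<beta>" "\<forall>k<n. t k = z k"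
    have "t k \<in> V k" for k
    proof (cases "k < n")
      case True
      then show ?thesis using t(2) V(2) by (simp add: PiE_iff)
    next
      case False
      then have "V k = {0..max_digit \<beta>}" using n by blast
      then show ?thesis using t(1) by simp
    qed
    then have "t \<in> Pi\<^sub>E UNIV V" by (simp add: PiE_iff)
    then show "t \<in> U" using V(3) by blast
  qed
qed

text \<open>Cylinders form a neighbourhood basis of the product topology, which turns the closure
  into a condition on finite prefixes.\<close>

lemma mem_beta_shift:
  "z \<in> beta_shift \<beta> \<longleftrightarrow>
     (\<forall>k. z k \<le> max_digit \<beta>) \<and> (\<forall>n. \<exists>x\<in>{0..<1}. \<forall>k<n. digit x k = z k)"
proof -
  have img: "beta_expansion \<beta> ` {0..<1} = digit ` {0..<1}"
    by (intro image_cong) (auto simp: expansion_eq_digit)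
  show ?thesis
  proof
    assume "z \<in> beta_shift \<beta>"
    then have top: "\<forall>k. z k \<le> max_digit \<beta>"
      and cl: "\<And>U. z \<in> U \<Longrightarrow> openin (full_shift_topology \<beta>) U \<Longrightarrow> \<exists>t\<in>digit ` {0..<1}. t \<in> U"
      unfolding beta_shift_def in_closure_of img topspace_full_shift by blast+
    have "\<exists>x\<in>{0..<1}. \<forall>k<n. digit x k = z k" for n
      using cl[OF _ openin_full_shift_cylinder[of z n]] top by auto
    then show "(\<forall>k. z k \<le> max_digit \<beta>) \<and> (\<forall>n. \<exists>x\<in>{0..<1}. \<forall>k<n. digit x k = z k)" using top by blast
  next
    assume z: "(\<forall>k. z k \<le> max_digit \<beta>) \<and> (\<forall>n. \<exists>x\<in>{0..<1}. \<forall>k<n. digit x k = z k)"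
    show "z \<in> beta_shift \<beta>"
      unfolding beta_shift_def in_closure_of img topspace_full_shift
    proof (intro conjI allI impI)
      fix U assume U: "z \<in> U \<and> openin (full_shift_topology \<beta>) U"
      then obtain n where n: "\<forall>t. (\<forall>k. t k \<le> max_digit \<beta>) \<longrightarrow> (\<forall>k<n. t k = z k) \<longrightarrow> t \<in> U"
        using cylinder_in_open[of U z] by blast
      obtain x where x: "x \<in> {0..<1}" "\<forall>k<n. digit x k = z k" using z by blast
      have "digit x \<in> U" using n x(2) expansion_eq_digit(2)[OF x(1)] by blast
      then show "\<exists>y. y \<in> digit ` {0..<1} \<and> y \<in> U" using x(1) by blast
    qed (use z in blast)
  qed
qed

lemma digit_in_beta_shift: "x \<in> {0..<1} \<Longrightarrow> digit x \<in> beta_shift \<beta>"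
  unfolding mem_beta_shift using expansion_eq_digit(2) by blast

lemma shift_in_beta_shift:
  assumes "z \<in> beta_shift \<beta>"
  shows "(shift ^^ i) z \<in> beta_shift \<beta>"
  unfolding mem_beta_shift funpow_shift
proof (intro conjI allI)
  show "z (i + k) \<le> max_digit \<beta>" for k using assms by (simp add: mem_beta_shift)
  fix n
  obtain x where x: "x \<in> {0..<1}" "\<forall>k<i + n. digit x k = z k" using assms unfolding mem_beta_shift by blast
  show "\<exists>x\<in>{0..<1}. \<forall>k<n. digit x k = z (i + k)"
    using x(2) by (intro bexI[OF _ iterate_in[OF x(1), of i]]) (simp add: digit_iterate)
qed

lemma digit_shift_orbit: "(shift ^^ i) (digit x) = digit ((T ^^ i) x)"
  by (simp add: funpow_shift digit_iterate fun_eq_iff)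

lemma compact_space_beta_shift: "compact_space (subtopology (full_shift_topology \<beta>) (beta_shift \<beta>))"
proof -
  have "compact_space (full_shift_topology \<beta>)"
    unfolding full_shift_topology_def compact_space_product_topology
    by (auto simp: compact_space_discrete_topology)
  then have "compactin (full_shift_topology \<beta>) (beta_shift \<beta>)"
    unfolding beta_shift_def by (intro closedin_compact_space closedin_closure_of)
  then show ?thesis by (rule compact_space_subtopology)
qed

lemma topspace_beta_shift: "topspace (subtopology (full_shift_topology \<beta>) (beta_shift \<beta>)) = beta_shift \<beta>"
  using mem_beta_shift topspace_full_shift by auto

lemma continuous_on_beta_shift_bounded:
  assumes "continuous_map (subtopology (full_shift_topology \<beta>) (beta_shift \<beta>)) euclideanreal \<phi>"
  obtains M where "\<And>z. z \<in> beta_shift \<beta> \<Longrightarrow> \<bar>\<phi> z\<bar> \<le> M"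
proof -
  have "compactin euclideanreal (\<phi> ` beta_shift \<beta>)"
    using image_compactin[OF compact_space_beta_shift[unfolded compact_space_def] assms]
    unfolding topspace_beta_shift .
  then have "bounded (\<phi> ` beta_shift \<beta>)" by (simp add: compact_imp_bounded)
  then show thesis using that by (auto simp: bounded_iff)
qed

text \<open>The Heine-Cantor argument with cylinders in place of balls: each point has a cylinder on
  which \<open>\<phi>\<close> stays within \<open>\<eta> / 2\<close> of its value, and finitely many
  of them cover.\<close>

lemma continuous_on_beta_shift_uniformly:
  assumes cont: "continuous_map (subtopology (full_shift_topology \<beta>) (beta_shift \<beta>)) euclideanreal \<phi>"
    and "\<eta> > 0"
  obtains m where "\<And>s t. s \<in> beta_shift \<beta> \<Longrightarrow> t \<in> beta_shift \<beta> \<Longrightarrow> (\<forall>k<m. s k = t k) \<Longrightarrow> \<bar>\<phi> s - \<phi> t\<bar> < \<eta>"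
proof -
  let ?X = "subtopology (full_shift_topology \<beta>) (beta_shift \<beta>)"
  have "\<forall>s\<in>beta_shift \<beta>. \<exists>n. \<forall>t\<in>beta_shift \<beta>. (\<forall>k<n. t k = s k) \<longrightarrow> \<bar>\<phi> t - \<phi> s\<bar> < \<eta> / 2"
  proof
    fix s assume s: "s \<in> beta_shift \<beta>"
    have "openin ?X {t \<in> topspace ?X. \<phi> t \<in> ball (\<phi> s) (\<eta> / 2)}"
      by (rule openin_continuous_map_preimage[OF cont]) simp
    then obtain U where U: "openin (full_shift_topology \<beta>) U"
      "{t \<in> topspace ?X. \<phi> t \<in> ball (\<phi> s) (\<eta> / 2)} = U \<inter> beta_shift \<beta>"
      unfolding openin_subtopology by blast
    have "s \<in> {t \<in> topspace ?X. \<phi> t \<in> ball (\<phi> s) (\<eta> / 2)}" using s \<open>\<eta> > 0\<close> by (simp only: topspace_beta_shift) simp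
    then have "s \<in> U" unfolding U(2) by blast
    obtain n where n: "\<forall>t. (\<forall>k. t k \<le> max_digit \<beta>) \<longrightarrow> (\<forall>k<n. t k = s k) \<longrightarrow> t \<in> U"
      using cylinder_in_open[OF U(1) \<open>s \<in> U\<close>] by blast
    have "\<bar>\<phi> t - \<phi> s\<bar> < \<eta> / 2" if t: "t \<in> beta_shift \<beta>" "\<forall>k<n. t k = s k" for t
    proof -
      have "\<forall>k. t k \<le> max_digit \<beta>" using t(1) unfolding mem_beta_shift by blast
      then have "t \<in> U" using n t(2) by blast
      then have "t \<in> {t \<in> topspace ?X. \<phi> t \<in> ball (\<phi> s) (\<eta> / 2)}" unfolding U(2) using t(1) by blast
      then show ?thesis by (simp add: dist_real_def abs_minus_commute)
    qed
    then show "\<exists>n. \<forall>t\<in>beta_shift \<beta>. (\<forall>k<n. t k = s k) \<longrightarrow> \<bar>\<phi> t - \<phi> s\<bar> < \<eta> / 2" by blast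
  qed
  from bchoice[OF this] obtain n where
    n: "\<forall>s\<in>beta_shift \<beta>. \<forall>t\<in>beta_shift \<beta>. (\<forall>k<n s. t k = s k) \<longrightarrow> \<bar>\<phi> t - \<phi> s\<bar> < \<eta> / 2"
    by (elim exE)
  define C where "C s = {t. (\<forall>k. t k \<le> max_digit \<beta>) \<and> (\<forall>k<n s. t k = s k)} \<inter> beta_shift \<beta>" for s
  have C_open: "openin ?X (C s)" if "s \<in> beta_shift \<beta>" for s
    unfolding C_def using that mem_beta_shift
    by (intro openin_subtopology_Int openin_full_shift_cylinder) blast
  have "compactin ?X (topspace ?X)" using compact_space_beta_shift by (simp add: compact_space_def)
  moreover have "openin ?X U" if "U \<in> C ` beta_shift \<beta>" for U using that C_open by blast
  moreover have "topspace ?X \<subseteq> \<Union> (C ` beta_shift \<beta>)"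
  proof
    fix s assume "s \<in> topspace ?X"
    then have s: "s \<in> beta_shift \<beta>" by (simp only: topspace_beta_shift)
    then have "s \<in> C s" unfolding C_def using mem_beta_shift by simp
    then show "s \<in> \<Union> (C ` beta_shift \<beta>)" using s by blast
  qed
  ultimately have "\<exists>F. finite F \<and> F \<subseteq> C ` beta_shift \<beta> \<and> topspace ?X \<subseteq> \<Union> F"
    by (rule compactinD)
  then obtain F where F: "finite F" "F \<subseteq> C ` beta_shift \<beta>" "topspace ?X \<subseteq> \<Union> F"
    by (elim exE conjE)
  obtain S where S: "S \<subseteq> beta_shift \<beta>" "finite S" "F = C ` S" using finite_subset_image[OF F(1,2)] by blast
  \<comment> \<open>The sum is merely a convenient upper bound for the finitely many lengths
    \<open>n s\<close>.\<close>
  define m where "m = (\<Sum>s\<in>S. n s)"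
  have m: "n s \<le> m" if "s \<in> S" for s unfolding m_def using S(2) that by (intro member_le_sum) auto
  show thesis
  proof (rule that)
    fix s t assume s: "s \<in> beta_shift \<beta>" and t: "t \<in> beta_shift \<beta>" and eq: "\<forall>k<m. s k = t k"
    obtain u where u: "u \<in> S" "s \<in> C u" using F(3) s unfolding topspace_beta_shift S(3) by blast
    have "\<forall>k<n u. s k = u k" using u(2) by (simp add: C_def)
    moreover have "\<forall>k<n u. t k = u k"
    proof (intro allI impI)
      fix k assume "k < n u"
      then show "t k = u k" using \<open>\<forall>k<n u. s k = u k\<close> eq m[OF u(1)] by (metis less_le_trans)
    qed
    ultimately have "\<bar>\<phi> s - \<phi> u\<bar> < \<eta> / 2" "\<bar>\<phi> t - \<phi> u\<bar> < \<eta> / 2" using n[rule_format, of u] S(1) u(1) s t by (simp_all add: subset_iff)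
    then show "\<bar>\<phi> s - \<phi> t\<bar> < \<eta>" by linarith
  qed
qed

text \<open>Closed balls of radius \<open>\<beta>^-N\<close> are the cylinders of order
  \<open>N\<close>, so here the mass bound passes to balls without loss in the exponent.\<close>

lemma beta_dist_le_iff: "beta_dist \<beta> s t \<le> 1 / \<beta> ^ N \<longleftrightarrow> (\<forall>k<N. s k = t k)"
proof (cases "s = t")
  case True
  then show ?thesis using beta_pow_pos[of N] by (simp add: beta_dist_def)
next
  case False
  let ?L = "LEAST n. s n \<noteq> t n"
  have neq: "s ?L \<noteq> t ?L" by (rule LeastI_ex[of "\<lambda>n. s n \<noteq> t n"]) (use False in blast)
  have same: "s k = t k" if "k < ?L" for k using not_less_Least[OF that] by simp
  have "N \<le> ?L \<longleftrightarrow> (\<forall>k<N. s k = t k)"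
  proof -
    have "\<forall>k<N. s k = t k" if "N \<le> ?L"
      by (intro allI impI same less_le_trans[OF _ that])
    moreover have "N \<le> ?L" if "\<forall>k<N. s k = t k"
      by (rule ccontr) (use that neq in simp)
    ultimately show ?thesis by (rule iffI)
  qed
  moreover have "(1 / \<beta>) ^ ?L \<le> 1 / \<beta> ^ N \<longleftrightarrow> N \<le> ?L"
    unfolding power_one_over inverse_le_iff_le[OF beta_pow_pos beta_pow_pos, unfolded inverse_eq_divide]
    by (rule power_increasing_iff[OF beta_gt_1])
  ultimately show ?thesis using False by (simp only: beta_dist_def if_False)
qed

lemma beta_dist_le_1: "beta_dist \<beta> s t \<le> 1"
  using beta_dist_le_iff[of s t 0] by simp

section \<open>The dimension in the shift\<close>

lemma mem_irregular_set_beta_shift: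
  assumes "x \<in> {0..<1}" "\<not> convergent (\<lambda>n. bsum (\<lambda>x. \<phi> (digit x)) n x / real n)"
  shows "digit x \<in> irregular_set (beta_shift \<beta>) shift \<phi>"
  using assms digit_in_beta_shift[OF assms(1)]
  by (simp add: irregular_set_def bsum_def digit_shift_orbit)

text \<open>A point of the closure with divergent averages need not be the expansion of a number.
  Each of its long prefixes is one, however, and the construction only asks for long words with low
  or high averages, not for one divergent orbit.\<close>

lemma irregular_beta_shift_dim:
  assumes cont: "continuous_map (subtopology (full_shift_topology \<beta>) (beta_shift \<beta>)) euclideanreal \<phi>"
    and ne: "irregular_set (beta_shift \<beta>) shift \<phi> \<noteq> {}"
  shows "hausdorff_dim (beta_shift \<beta>) (beta_dist \<beta>) (irregular_set (beta_shift \<beta>) shift \<phi>) = 1"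
proof -
  interpret I: Metric_space "beta_shift \<beta>" "beta_dist \<beta>" by (rule Metric_space_beta_dist[OF beta_gt_1])
  obtain M where M: "\<And>z. z \<in> beta_shift \<beta> \<Longrightarrow> \<bar>\<phi> z\<bar> \<le> M"
    using continuous_on_beta_shift_bounded[OF cont] by blast
  define \<psi> where "\<psi> x = \<phi> (digit x)" for x
  have bdd: "\<bar>\<psi> x\<bar> \<le> M" if "x \<in> {0..<1}" for x
    unfolding \<psi>_def by (rule M[OF digit_in_beta_shift[OF that]])
  have dc: "digit_continuous \<psi>"
    unfolding digit_continuous_def
  proof (intro allI impI)
    fix \<eta> :: real assume \<eta>: "\<eta> > 0"
    obtain m where m: "\<And>s t. s \<in> beta_shift \<beta> \<Longrightarrow> t \<in> beta_shift \<beta> \<Longrightarrow> (\<forall>k<m. s k = t k) \<Longrightarrow> \<bar>\<phi> s - \<phi> t\<bar> < \<eta>"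
      using continuous_on_beta_shift_uniformly[OF cont \<eta>] by blast
    show "\<exists>m. \<forall>x\<in>{0..<1}. \<forall>y\<in>{0..<1}. (\<forall>k<m. digit x k = digit y k) \<longrightarrow> \<bar>\<psi> x - \<psi> y\<bar> < \<eta>"
      unfolding \<psi>_def using m[OF digit_in_beta_shift digit_in_beta_shift] by blast
  qed
  obtain z where z: "z \<in> beta_shift \<beta>" "\<not> convergent (\<lambda>n. 1 / real n * (\<Sum>i<n. \<phi> ((shift ^^ i) z)))"
    using ne unfolding irregular_set_def by blast
  define X where "X n = (\<Sum>i<n. \<phi> ((shift ^^ i) z))" for n
  have M0: "0 \<le> M" using bdd[of 0] by simp
  have avg: "\<bar>X n / real n\<bar> \<le> M" for n
  proof (cases "n = 0")
    case False
    have "\<bar>X n\<bar> \<le> (\<Sum>i<n. \<bar>\<phi> ((shift ^^ i) z)\<bar>)" unfolding X_def by (rule sum_abs)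
    also have "\<dots> \<le> (\<Sum>i<n. M)" by (intro sum_mono M shift_in_beta_shift z(1))
    finally show ?thesis using False by (simp add: abs_divide field_simps)
  qed (use M0 in simp)
  have nc: "\<not> convergent (\<lambda>n. X n / real n)" using z(2) by (simp add: X_def)
  obtain a b where ab: "a < b" "\<And>n0. \<exists>n\<ge>n0. X n / real n < a" "\<And>n0. \<exists>n\<ge>n0. X n / real n > b"
    using oscillation_of_not_convergent[OF avg nc] by blast
  \<comment> \<open>A third of the gap, so that \<open>a + \<eta> < b - \<eta>\<close> survives the
    passage from \<open>z\<close> to nearby expansions.\<close>
  define \<eta> where "\<eta> = (b - a) / 3"
  have \<eta>: "\<eta> > 0" "a + \<eta> < b - \<eta>" using ab(1) by (simp_all add: \<eta>_def field_simps)
  obtain m where m: "\<And>s t. s \<in> beta_shift \<beta> \<Longrightarrow> t \<in> beta_shift \<beta> \<Longrightarrow> (\<forall>k<m. s k = t k) \<Longrightarrow> \<bar>\<phi> s - \<phi> t\<bar> < \<eta>"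
    using continuous_on_beta_shift_uniformly[OF cont \<eta>(1)] by blast
  have near: "\<exists>x\<in>{0..<1}. \<bar>bsum \<psi> n x - X n\<bar> \<le> real n * \<eta>" for n
  proof -
    \<comment> \<open>The \<open>m\<close> extra digits keep all of the first \<open>n\<close>
      shifts in agreement on \<open>m\<close> digits.\<close>
    obtain x where x: "x \<in> {0..<1}" "\<forall>k<n + m. digit x k = z k" using z(1) unfolding mem_beta_shift by blast
    have "\<bar>bsum \<psi> n x - X n\<bar> \<le> (\<Sum>i<n. \<bar>\<psi> ((T ^^ i) x) - \<phi> ((shift ^^ i) z)\<bar>)"
      unfolding bsum_def X_def sum_subtractf[symmetric] by (rule sum_abs)
    also have "\<dots> \<le> (\<Sum>i<n. \<eta>)"
    proof (rule sum_mono)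
      fix i assume "i \<in> {..<n}"
      then have "\<forall>k<m. digit ((T ^^ i) x) k = (shift ^^ i) z k" using x(2) by (simp add: digit_iterate funpow_shift)
      then have "\<bar>\<phi> (digit ((T ^^ i) x)) - \<phi> ((shift ^^ i) z)\<bar> < \<eta>"
        by (intro m digit_in_beta_shift iterate_in x(1) shift_in_beta_shift z(1))
      then show "\<bar>\<psi> ((T ^^ i) x) - \<phi> ((shift ^^ i) z)\<bar> \<le> \<eta>" by (simp add: \<psi>_def)
    qed
    finally show ?thesis using x(1) by auto
  qed
  have lo: "\<exists>n\<ge>n0. \<exists>x\<in>{0..<1}. bsum \<psi> n x < (a + \<eta>) * real n" for n0
  proof -
    obtain n where n: "n \<ge> max 1 n0" "X n / real n < a" using ab(2) by blast
    then have "X n < a * real n" by (simp add: pos_divide_less_eq)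
    moreover obtain x where x: "x \<in> {0..<1}" "\<bar>bsum \<psi> n x - X n\<bar> \<le> real n * \<eta>" using near by blast
    ultimately have "bsum \<psi> n x < a * real n + real n * \<eta>" by linarith
    then show ?thesis using n(1) x(1) by (intro exI[of _ n] conjI bexI[of _ x]) (simp_all add: algebra_simps)
  qed
  have hi: "\<exists>n\<ge>n0. \<exists>x\<in>{0..<1}. bsum \<psi> n x > (b - \<eta>) * real n" for n0
  proof -
    obtain n where n: "n \<ge> max 1 n0" "X n / real n > b" using ab(3) by blast
    then have "X n > b * real n" by (simp add: pos_less_divide_eq)
    moreover obtain x where x: "x \<in> {0..<1}" "\<bar>bsum \<psi> n x - X n\<bar> \<le> real n * \<eta>" using near by blast
    ultimately have "bsum \<psi> n x > b * real n - real n * \<eta>" by linarith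
    then show ?thesis using n(1) x(1) by (intro exI[of _ n] conjI bexI[of _ x]) (simp_all add: algebra_simps)
  qed
  show ?thesis
  proof (rule hausdorff_dim_eq_1)
    fix \<alpha> :: real assume \<alpha>: "0 < \<alpha>" "\<alpha> < 1"
    define s where "s = (\<alpha> + 1) / 2"
    have s: "0 < s" "\<alpha> < s" "s < 1" using \<alpha> by (simp_all add: s_def field_simps)
    have "\<exists>(h :: real \<Rightarrow> real) K. (\<forall>y\<in>{0..<1}. h y \<in> {0..<1} \<and> \<not> convergent (\<lambda>n. bsum \<psi> n (h y) / real n)) \<and>
      0 \<le> K \<and> (\<forall>N t. outer_measure_of lborel {y \<in> {0..<1}. \<forall>k<N. digit (h y) k = t k}
        \<le> ennreal (K * \<beta> powr (- (s * real N))))"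
      by (rule irregular_mass_distribution[OF bdd dc \<eta>(2) lo hi s(1,3)])
    then obtain h :: "real \<Rightarrow> real" and K where h: "\<forall>y\<in>{0..<1}. h y \<in> {0..<1} \<and> \<not> convergent (\<lambda>n. bsum \<psi> n (h y) / real n)"
      and K: "K \<ge> 0" and mass: "\<forall>N t. outer_measure_of lborel {y \<in> {0..<1}. \<forall>k<N. digit (h y) k = t k}
        \<le> ennreal (K * \<beta> powr (- (s * real N)))" by (elim exE conjE)
    show "hausdorff_measure (beta_shift \<beta>) (beta_dist \<beta>) (irregular_set (beta_shift \<beta>) shift \<phi>) \<alpha> = \<infinity>"
    proof (rule I.hausdorff_measure_infiniteI[OF \<alpha>(1) s(2)])
      show "0 < K * \<beta> powr s + 1" using K by (intro add_nonneg_pos mult_nonneg_nonneg) auto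
      show "digit (h y) \<in> irregular_set (beta_shift \<beta>) shift \<phi>" if "y \<in> {0..<1}" for y
        using h that unfolding \<psi>_def by (intro mem_irregular_set_beta_shift) simp_all
      fix x r assume x: "x \<in> beta_shift \<beta>" and r: "(0::real) < r"
      define B where "B = I.mball x r"
      have B: "x \<in> B" using x r by (simp add: B_def)
      have D: "0 \<le> mdiam (beta_dist \<beta>) B" unfolding B_def by (rule I.mdiam_mball_nonneg)
      have D1: "mdiam (beta_dist \<beta>) B \<le> 1" by (rule mdiam_le) (use beta_dist_le_1 in auto)
      have "outer_measure_of lborel {y \<in> {0..<1}. digit (h y) \<in> B}
          \<le> ennreal (K * \<beta> powr s * mdiam (beta_dist \<beta>) B powr s)"
      proof (rule mass_bound_of_scales[OF D D1 K s(1)])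
        fix N :: nat assume N: "mdiam (beta_dist \<beta>) B \<le> 1 / \<beta> ^ N"
        have near: "\<forall>k<N. w k = x k" if "w \<in> B" for w
        proof -
          have "beta_dist \<beta> w x \<le> mdiam (beta_dist \<beta>) B"
            by (rule dist_le_mdiam[OF that B beta_dist_le_1])
          then show ?thesis using N beta_dist_le_iff by (meson order_trans)
        qed
        have "{y \<in> {0..<1}. digit (h y) \<in> B} \<subseteq> {y \<in> {0..<1}. \<forall>k<N. digit (h y) k = x k}"
          using near by blast
        then have "outer_measure_of lborel {y \<in> {0..<1}. digit (h y) \<in> B}
            \<le> outer_measure_of lborel {y \<in> {0..<1}. \<forall>k<N. digit (h y) k = x k}"
          by (rule outer_measure_of_mono)
        also note mass[rule_format]
        finally show "outer_measure_of lborel {y \<in> {0..<1}. digit (h y) \<in> B}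
            \<le> ennreal (K * \<beta> powr (- (s * real N)))" .
      qed
      also have "\<dots> \<le> ennreal ((K * \<beta> powr s + 1) * mdiam (beta_dist \<beta>) B powr s)"
        by (intro ennreal_leI mult_right_mono) simp_all
      finally show "outer_measure_of lborel {y \<in> {0..<1}. digit (h y) \<in> I.mball x r}
          \<le> ennreal ((K * \<beta> powr s + 1) * mdiam (beta_dist \<beta>) (I.mball x r) powr s)"
        unfolding B_def .
    qed
  next
    fix \<alpha> :: real assume \<alpha>: "1 < \<alpha>"
    show "hausdorff_measure (beta_shift \<beta>) (beta_dist \<beta>) (irregular_set (beta_shift \<beta>) shift \<phi>) \<alpha> \<noteq> \<infinity>"
    proof (rule I.hausdorff_measure_finiteI)
      show "0 < \<alpha>" using \<alpha> by simp
      fix \<delta> :: real assume \<delta>: "\<delta> > 0"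
      have "\<delta> / 2 > 0" using \<delta> by simp
      then obtain N where N: "1 / \<beta> ^ N < \<delta> / 2" by (rule small_power)
      obtain c where c: "prefix_cover {0..<1} N c" "real c \<le> 5 * \<beta> / (\<beta> - 1) * \<beta> ^ N"
        using prefix_cover_unit_interval by blast
      obtain S where S: "finite S" "card S \<le> c" "\<forall>y\<in>{0..<1}. \<exists>t\<in>S. \<forall>i<N. digit y i = t i"
        using c(1) unfolding prefix_cover_def by blast
      define p where "p t = (SOME x. x \<in> {0..<1} \<and> (\<forall>k<N. digit x k = t k))" for t
      have p: "p t \<in> {0..<1} \<and> (\<forall>k<N. digit (p t) k = t k)"
        if "x \<in> {0..<1}" "\<forall>k<N. digit x k = t k" for x t
        unfolding p_def by (rule someI[of _ x]) (use that in simp)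
      \<comment> \<open>Only words that occur are kept, since the choice \<open>p t\<close> is
        meaningless for the others.\<close>
      define P where "P = (\<lambda>t. digit (p t)) ` {t \<in> S. \<exists>x\<in>{0..<1}. \<forall>k<N. digit x k = t k}"
      have P: "finite P" "card P \<le> card S"
      proof -
        show "finite P" unfolding P_def using S(1) by simp
        have "card P \<le> card {t \<in> S. \<exists>x\<in>{0..<1}. \<forall>k<N. digit x k = t k}"
          unfolding P_def using S(1) by (intro card_image_le) simp
        also have "\<dots> \<le> card S" using S(1) by (intro card_mono) auto
        finally show "card P \<le> card S" .
      qed
      have P_sub: "P \<subseteq> beta_shift \<beta>"
      proof
        fix w assume "w \<in> P"
        then obtain t x where "w = digit (p t)" "x \<in> {0..<1}" "\<forall>k<N. digit x k = t k" by (auto simp: P_def)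
        then show "w \<in> beta_shift \<beta>" using p[of x t] digit_in_beta_shift by simp
      qed
      \<comment> \<open>A common prefix gives only distance at most \<open>\<beta>^-N\<close>, while
        balls are open; hence the doubled radius, and the 4 in the constant below.\<close>
      have cover: "irregular_set (beta_shift \<beta>) shift \<phi> \<subseteq> (\<Union>w\<in>P. I.mball w (2 / \<beta> ^ N))"
      proof
        fix v assume "v \<in> irregular_set (beta_shift \<beta>) shift \<phi>"
        then have v: "v \<in> beta_shift \<beta>" by (simp add: irregular_set_def)
        then obtain y where y: "y \<in> {0..<1}" "\<forall>k<N. digit y k = v k" unfolding mem_beta_shift by blast
        obtain t where t: "t \<in> S" "\<forall>k<N. digit y k = t k" using S(3) y(1) by blast
        have w: "digit (p t) \<in> P" unfolding P_def using t y(1) by blast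
        have "\<forall>k<N. digit (p t) k = v k" using p[OF y(1) t(2)] t(2) y(2) by simp
        then have "beta_dist \<beta> (digit (p t)) v \<le> 1 / \<beta> ^ N" using beta_dist_le_iff by blast
        also have "\<dots> < 2 / \<beta> ^ N" using beta_pow_pos[of N] by (simp add: divide_strict_right_mono)
        finally have "v \<in> I.mball (digit (p t)) (2 / \<beta> ^ N)" using v w P_sub by auto
        then show "v \<in> (\<Union>w\<in>P. I.mball w (2 / \<beta> ^ N))" using w by blast
      qed
      have sum: "real (card P) * (2 * (2 / \<beta> ^ N)) powr \<alpha> \<le> 5 * \<beta> / (\<beta> - 1) * 4 powr \<alpha>"
      proof -
        have "real (card P) \<le> 5 * \<beta> / (\<beta> - 1) * \<beta> ^ N" using P(2) S(2) c(2) by linarith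
        then have "real (card P) * (2 * (2 / \<beta> ^ N)) powr \<alpha>
            \<le> 5 * \<beta> / (\<beta> - 1) * \<beta> ^ N * (2 * (2 / \<beta> ^ N)) powr \<alpha>"
          by (rule mult_right_mono) simp
        also have "\<dots> = 5 * \<beta> / (\<beta> - 1) * 4 powr \<alpha> * (\<beta> ^ N / (\<beta> ^ N) powr \<alpha>)"
          using beta_pow_pos[of N] by (simp add: powr_divide)
        also have "\<dots> \<le> 5 * \<beta> / (\<beta> - 1) * 4 powr \<alpha> * 1"
        proof (rule mult_left_mono)
          have "1 \<le> \<beta> ^ N" using beta_gt_1 by (intro one_le_power) simp
          then have "(\<beta> ^ N) powr 1 \<le> (\<beta> ^ N) powr \<alpha>" using \<alpha> by (intro powr_mono) auto
          moreover have "0 < (\<beta> ^ N) powr \<alpha>" using beta_pos by simp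
          ultimately show "\<beta> ^ N / (\<beta> ^ N) powr \<alpha> \<le> 1" using beta_pow_pos[of N] by (simp add: divide_le_eq_1_pos)
          show "0 \<le> 5 * \<beta> / (\<beta> - 1) * 4 powr \<alpha>" using beta_gt_1 by simp
        qed
        finally show ?thesis by simp
      qed
      show "\<exists>X r. finite X \<and> X \<subseteq> beta_shift \<beta> \<and> 0 < r \<and> r \<le> \<delta> \<and>
          irregular_set (beta_shift \<beta>) shift \<phi> \<subseteq> (\<Union>x\<in>X. I.mball x r) \<and>
          real (card X) * (2 * r) powr \<alpha> \<le> 5 * \<beta> / (\<beta> - 1) * 4 powr \<alpha>"
      proof (intro exI[of _ P] exI[of _ "2 / \<beta> ^ N"] conjI P(1) P_sub cover sum)
        show "0 < 2 / \<beta> ^ N" using beta_pow_pos[of N] by simp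
        show "2 / \<beta> ^ N \<le> \<delta>" using N by simp
      qed
    qed
  qed
qed

end

theorem theorem5p4:
  fixes \<beta> :: real
  assumes "\<beta> > 1"
  shows
    "(\<forall>\<phi>. continuous_map (subtopology (full_shift_topology \<beta>) (beta_shift \<beta>)) euclideanreal \<phi> \<longrightarrow>
        irregular_set (beta_shift \<beta>) shift \<phi> \<noteq> {} \<longrightarrow>
        hausdorff_dim (beta_shift \<beta>) (beta_dist \<beta>)
          (irregular_set (beta_shift \<beta>) shift \<phi>) = 1) \<and>
     (\<forall>\<phi> :: real \<Rightarrow> real. continuous_on {0..1} \<phi> \<longrightarrow>
        irregular_set {0..<1} (beta_map \<beta>) \<phi> \<noteq> {} \<longrightarrow>
        hausdorff_dim {0..<1} dist (irregular_set {0..<1} (beta_map \<beta>) \<phi>) = 1)"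
proof -
  interpret beta_transformation \<beta> by unfold_locales (fact assms)
  show ?thesis using irregular_beta_shift_dim irregular_interval_dim by blast
qed

end
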